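(* Let $n\ge 3$ and $d\ge 2$ be integers. For every integer $i$ with $$0\leq i\leq \frac{2^{d-1}}{n-1}\left[(1+(n-1)!)^{d-1}-\left(1+\frac{(n-1)!}{2}\right)^{d-1}\right],$$ there exists a u-word (with incomparable elements allowed) for $d$-dimensional permutations of length $n$ that has length (number of columns) $(n!)^{d-1}+n-1-i(n-1)$.
   Context: A $d$-dimensional permutation of length $n$ (a $d$-dimensional $n$-permutation) is an ordered $(d-1)$-tuple $(\pi^2,\dots,\pi^d)$ of permutations $\pi^j=\pi^j_1\cdots\pi^j_n\in S_n$, written as a $(d-1)\times n$ matrix whose rows are the one-line notations of $\pi^2,\dots,\pi^d$. There are $(n!)^{d-1}$ of them. Let $U$ be a matrix with $d-1$ rows and $L\ge n$ columns with positive integer entries. A window of $U$ is a $(d-1)\times n$ submatrix consisting of $n$ consecutive columns (non-cyclically), so there are $L-n+1$ windows, indexed by starting position. Equal entries in the same row of a window are regarded as incomparable, and a window encodes all matrices obtained by taking, independently in each row, linear extensions: a window $W=(w_{j,m})_{2\le j\le d,\,1\le m\le n}$ encodes (covers) the $d$-dimensional $n$-permutation $(\pi^2,\dots,\pi^d)$ if and only if for every row $j$ and all $a,b\in\{1,\dots,n\}$, $w_{j,a}<w_{j,b}$ implies $\pi^j_a<\pi^j_b$. (For example, the row $121$ encodes $132$ and $231$. If all entries in each row of $W$ are distinct, then $W$ encodes exactly one permutation, namely its row-wise reduced form.) The matrix $U$ is a u-word (universal word) for $d$-dimensional $n$-permutations if every $d$-dimensional $n$-permutation is encoded by exactly one window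 of $U$. The length of $U$ is its number of columns $L$. *)

theory Defs
  imports Complex_Main "HOL-Library.FuncSet" "HOL-Combinatorics.Permutations"
begin

text \<open>A \<open>d\<close>-dimensional \<open>n\<close>-permutation is a tuple indexed by \<open>j = 2, \<dots>, d\<close> of permutations of
  \<open>{1..n}\<close>; the entry \<open>\<pi> j a\<close> is the \<open>a\<close>-th letter of the one-line notation of the row \<open>j\<close>.
  Since \<open>PiE\<close> and \<open>permutes\<close> fix the values outside the index ranges, each tuple has
  exactly one representative.\<close>

definition multi_perms :: "nat \<Rightarrow> nat \<Rightarrow> (nat \<Rightarrow> nat \<Rightarrow> nat) set" where
  "multi_perms d n = (\<Pi>\<^sub>E j\<in>{2..d}. {p. p permutes {1..n}})"

text \<open>Matrices are functions of a row index in \<open>{2..d}\<close> and a column index starting at 1; values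
  outside the relevant ranges are never inspected. The window starting at column \<open>s \<ge> 1\<close> has
  columns \<open>s, \<dots>, s + n - 1\<close> of \<open>U\<close>, renumbered \<open>1, \<dots>, n\<close>.\<close>

definition window :: "(nat \<Rightarrow> nat \<Rightarrow> nat) \<Rightarrow> nat \<Rightarrow> nat \<Rightarrow> nat \<Rightarrow> nat" where
  "window U s = (\<lambda>j m. U j (s + m - 1))"

definition encodes :: "nat \<Rightarrow> nat \<Rightarrow> (nat \<Rightarrow> nat \<Rightarrow> nat) \<Rightarrow> (nat \<Rightarrow> nat \<Rightarrow> nat) \<Rightarrow> bool" where
  "encodes d n W \<pi> \<longleftrightarrow>
     (\<forall>j\<in>{2..d}. \<forall>a\<in>{1..n}. \<forall>b\<in>{1..n}. W j a < W j b \<longrightarrow> \<pi> j a < \<pi> j b)"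

text \<open>\<open>u_word d n L U\<close>: the matrix \<open>U\<close> with rows \<open>2, \<dots>, d\<close> and \<open>L\<close> columns is a u-word. Distinct
  starting positions count as distinct windows, even if the windows have equal entries.\<close>

definition u_word :: "nat \<Rightarrow> nat \<Rightarrow> nat \<Rightarrow> (nat \<Rightarrow> nat \<Rightarrow> nat) \<Rightarrow> bool" where
  "u_word d n L U \<longleftrightarrow>
     n \<le> L \<and>
     (\<forall>j\<in>{2..d}. \<forall>c\<in>{1..L}. 0 < U j c) \<and>
     (\<forall>\<pi>\<in>multi_perms d n. \<exists>!s. s \<in> {1..L - n + 1} \<and> encodes d n (window U s) \<pi>)"

end

theory Submission
  imports Defs "Graph_Theory.Euler"
begin

text \<open>Consider the digraph whose vertices are the tuples of order patterns on \<open>n - 1\<close> columns and whose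
  arcs are the tuples of permutations, leading from the pattern of the first to that of the last
  \<open>n - 1\<close> columns. Permutations of a row that differ only by exchanging the values of the first and
  the last letter, these values being adjacent, give parallel arcs, and a window with equal ends
  encodes both. Hence a subcube of such arcs can be merged into one arc. Take the classes of parallel
  arcs in which every row is either monotone (a loop) or of this exchangeable kind. The latter rows
  move to their cyclic shift, so the classes with at least one such row form cycles of length
  \<open>n - 1\<close>; replacing a class by any smaller number of subcubes, the same along each cycle,
  keeps the digraph balanced and connected. The number of arcs drops by \<open>n - 1\<close> for each unit, up to
  a total of \<open>(2 + 2 (n - 1)!) ^ (d - 1) - (2 + (n - 1)!) ^ (d - 1)\<close>. An Eulerian trail spells the word.\<close>

section \<open>Invariant weights and refined partitions\<close>

text \<open>Each point of positive capacity lies on a \<open>T\<close>-orbit of exactly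
  \<open>N\<close> points, on which \<open>cap\<close> is constant. Raising the weight by 1 on one
  whole orbit keeps it invariant and adds \<open>N\<close> to the sum, so the multiples of
  \<open>N\<close> are reached one after another.\<close>

lemma invariant_weight_with_sum:
  fixes T :: "'a \<Rightarrow> 'a" and cap :: "'a \<Rightarrow> nat"
  assumes fin: "finite C" and T: "bij_betw T C C" and N: "N > 0"
    and cap_T: "\<And>c. c \<in> C \<Longrightarrow> cap (T c) = cap c"
    and period: "\<And>c. c \<in> C \<Longrightarrow> cap c > 0 \<Longrightarrow> (T ^^ N) c = c"
    and exact: "\<And>c k. c \<in> C \<Longrightarrow> cap c > 0 \<Longrightarrow> 0 < k \<Longrightarrow> k < N \<Longrightarrow> (T ^^ k) c \<noteq> c"
    and le: "i * N \<le> (\<Sum>c\<in>C. cap c)"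
  shows "\<exists>l. (\<forall>c\<in>C. l c \<le> cap c \<and> l (T c) = l c) \<and> (\<Sum>c\<in>C. l c) = i * N"
  using le
proof (induction i)
  case 0
  show ?case by (rule exI[of _ "\<lambda>_. 0"]) simp
next
  case (Suc i)
  then obtain l where l: "\<And>c. c \<in> C \<Longrightarrow> l c \<le> cap c" "\<And>c. c \<in> C \<Longrightarrow> l (T c) = l c"
    "(\<Sum>c\<in>C. l c) = i * N"
    by auto
  have "(\<Sum>c\<in>C. l c) < (\<Sum>c\<in>C. cap c)" using l(3) Suc.prems N by simp
  \<comment> \<open>A point with room left has positive capacity, so \<open>period\<close> and
    \<open>exact\<close> apply to it; since \<open>l\<close> and \<open>cap\<close> are invariant,
    there is room on its whole orbit.\<close>
  then obtain c where c: "c \<in> C" "l c < cap c"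
    using sum_mono[of C cap l] by (meson not_le)
  have TC: "T x \<in> C" if "x \<in> C" for x using T that by (auto dest: bij_betwE)
  have TkC: "(T ^^ k) c \<in> C" for k by (induction k) (auto simp: c TC)
  have lk: "l ((T ^^ k) c) = l c" "cap ((T ^^ k) c) = cap c" for k
    by (induction k) (auto simp: l TkC cap_T)
  define O' where "O' = (\<lambda>k. (T ^^ k) c) ` {..<N}"
  have OC: "O' \<subseteq> C" using TkC by (auto simp: O'_def)
  have injT: "inj_on (T ^^ k) C" for k
  proof (induction k)
    case (Suc k)
    have "(T ^^ k) ` C \<subseteq> C"
      by (induction k) (auto simp: TC)
    then have "inj_on (T \<circ> (T ^^ k)) C" using Suc T
      by (intro comp_inj_on) (auto simp: bij_betw_def intro: inj_on_subset)
    then show ?case by (simp only: funpow.simps)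
  qed simp
  have inj: "inj_on (\<lambda>k. (T ^^ k) c) {..<N}"
  proof (rule linorder_inj_onI)
    fix a b assume ab: "a < b" "a \<in> {..<N}" "b \<in> {..<N}"
    show "(T ^^ a) c \<noteq> (T ^^ b) c"
    proof
      assume eq: "(T ^^ a) c = (T ^^ b) c"
      have "(T ^^ b) c = (T ^^ a) ((T ^^ (b - a)) c)"
        using ab by (metis comp_apply funpow_add le_add_diff_inverse less_imp_le)
      then have "c = (T ^^ (b - a)) c" using eq injT[of a] TkC c(1) by (auto dest: inj_onD)
      moreover have "0 < b - a" "b - a < N" "0 < cap c" using ab c by auto
      ultimately show False using exact[OF c(1)] by metis
    qed
  qed auto
  have cardO: "card O' = N" unfolding O'_def using card_image[OF inj] by simp
  \<comment> \<open>Both directions matter: for the new weight to be invariant, no point outside the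
    orbit may be mapped into it.\<close>
  have TO: "T x \<in> O' \<longleftrightarrow> x \<in> O'" if x: "x \<in> C" for x
  proof
    assume "x \<in> O'"
    then obtain k where k: "k < N" "x = (T ^^ k) c" by (auto simp: O'_def)
    show "T x \<in> O'"
    proof (cases "Suc k = N")
      case True
      then have "T x = (T ^^ 0) c" using period[OF c(1)] c k by auto
      then show ?thesis using N by (auto simp: O'_def intro: image_eqI[of _ _ 0])
    next
      case False
      then show ?thesis using k by (auto simp: O'_def intro!: image_eqI[of _ _ "Suc k"])
    qed
  next
    assume "T x \<in> O'"
    then obtain k where k: "k < N" "T x = (T ^^ k) c" by (auto simp: O'_def)
    have "\<exists>k'<N. T x = T ((T ^^ k') c)"
    proof (cases k)
      case 0
      then have "T x = (T ^^ N) c" using period[OF c(1)] c k by auto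
      then show ?thesis using N by (intro exI[of _ "N - 1"]) (cases N; auto)
    next
      case (Suc k')
      then show ?thesis using k by (intro exI[of _ k']) simp
    qed
    then show "x \<in> O'" using T TkC x by (auto simp: O'_def bij_betw_def dest: inj_onD)
  qed
  let ?l = "\<lambda>x. if x \<in> O' then l x + 1 else l x"
  have "(\<Sum>x\<in>C. ?l x) = (\<Sum>x\<in>C. l x + (if x \<in> O' then 1 else 0))"
    by (intro sum.cong) auto
  also have "\<dots> = i * N + card O'"
    using fin OC by (simp add: sum.distrib l(3) sum.If_cases Int_absorb1)
  finally have sum_l: "(\<Sum>x\<in>C. ?l x) = Suc i * N" by (simp add: cardO)
  have "?l x \<le> cap x \<and> ?l (T x) = ?l x" if "x \<in> C" for x
  proof (cases "x \<in> O'")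
    case True
    then obtain k where "x = (T ^^ k) c" by (auto simp: O'_def)
    then have "l x = l c" "cap x = cap c" using lk by auto
    then show ?thesis using that True TO l(2) c(2) by simp
  qed (use that TO l in simp)
  then show ?case using sum_l by (intro exI[of _ ?l] conjI ballI) (simp_all only:)
qed

text \<open>Starting from the whole box, a block with at least two elements is cut in a coordinate
  where two of its elements differ. Both pieces are again nonempty boxes and the number of blocks
  grows by one, so every number up to the cardinality occurs.\<close>

lemma partition_into_boxes:
  fixes c :: "'a \<Rightarrow> 'b set"
  assumes I: "finite I" and c: "\<And>j. j \<in> I \<Longrightarrow> finite (c j)" "\<And>j. j \<in> I \<Longrightarrow> c j \<noteq> {}"
    and m: "1 \<le> m" "m \<le> card (PiE I c)"
  shows "\<exists>P. partition_on (PiE I c) P \<and> card P = m \<and>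
    (\<forall>B\<in>P. \<exists>b. B = PiE I b \<and> (\<forall>j\<in>I. b j \<subseteq> c j \<and> b j \<noteq> {}))"
  using m
proof (induction m rule: nat_induct_at_least)
  case base
  have "PiE I c \<noteq> {}" using c by (auto simp: PiE_eq_empty_iff)
  then have "partition_on (PiE I c) {PiE I c}" by (rule partition_on_space)
  then show ?case using c by (intro exI[of _ "{PiE I c}"] conjI) auto
next
  case (Suc m)
  then obtain P where P: "partition_on (PiE I c) P" "card P = m"
    "\<And>B. B \<in> P \<Longrightarrow> \<exists>b. B = PiE I b \<and> (\<forall>j\<in>I. b j \<subseteq> c j \<and> b j \<noteq> {})"
    by auto
  have fin: "finite (PiE I c)" using I c by (auto intro: finite_PiE)
  have finP: "finite P" using P(1) fin finite_elements by blast
  \<comment> \<open>If no block had two elements, there would be at most \<open>m\<close> elements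
    altogether.\<close>
  have "\<not> (\<forall>B\<in>P. card B \<le> 1)"
  proof
    assume "\<forall>B\<in>P. card B \<le> 1"
    then have "(\<Sum>B\<in>P. card B) \<le> card P" using sum_mono[of P card "\<lambda>_. 1"] by simp
    moreover have "card (PiE I c) = (\<Sum>B\<in>P. card B)"
      using P(1) fin finite_subset[of _ "PiE I c"]
      by (intro product_partition) (auto simp: partition_on_def)
    ultimately show False using P(2) Suc.prems by simp
  qed
  then obtain B where B: "B \<in> P" "1 < card B" by (meson not_le)
  obtain b where b: "B = PiE I b" "\<And>j. j \<in> I \<Longrightarrow> b j \<subseteq> c j" "\<And>j. j \<in> I \<Longrightarrow> b j \<noteq> {}"
    using P(3)[OF B(1)] by auto
  obtain f g where fg: "f \<in> B" "g \<in> B" "f \<noteq> g"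
    using B(2) by (metis card_le_Suc0_iff_eq One_nat_def card.infinite not_le zero_le)
  then obtain j where j: "j \<in> I" "f j \<noteq> g j" using b by (metis PiE_ext)
  have fj: "f j \<in> b j" "g j \<in> b j" using fg b j by auto
  \<comment> \<open>The value \<open>f j\<close> goes to one piece and \<open>g j\<close> to the
    other, so neither piece is empty.\<close>
  define B1 where "B1 = PiE I (b(j := {f j}))"
  define B2 where "B2 = PiE I (b(j := b j - {f j}))"
  have un: "B1 \<union> B2 = B" unfolding B1_def B2_def b(1) using j fj
    by (auto simp: PiE_iff split: if_splits)
  have dj: "B1 \<inter> B2 = {}" unfolding B1_def B2_def using j by (auto simp: PiE_iff dest!: bspec[of I _ j])
  have ne: "B1 \<noteq> {}" "B2 \<noteq> {}" unfolding B1_def B2_def using b(3) j fj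
    by (auto simp: PiE_eq_empty_iff)
  have B_other: "B \<inter> X = {}" if "X \<in> P - {B}" for X
    using partition_onD2[OF P(1)] B(1) that by (intro disjointD) auto
  let ?P = "insert B1 (insert B2 (P - {B}))"
  have UP: "\<Union>P = B \<union> \<Union>(P - {B})" using B by auto
  have "partition_on (PiE I c) ?P"
  proof (rule partition_onI)
    show "\<Union>?P = PiE I c" using un UP partition_onD1[OF P(1)] by auto
    show "{} \<notin> ?P" using ne partition_onD3[OF P(1)] by auto
  next
    fix X Y assume XY: "X \<in> ?P" "Y \<in> ?P" "X \<noteq> Y"
    have old: "disjnt Z Z'" if "Z \<in> P - {B}" "Z' \<in> P - {B}" "Z \<noteq> Z'" for Z Z'
      using partition_onD2[OF P(1)] that by (auto simp: pairwise_def)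
    have new: "disjnt B1 Z \<and> disjnt B2 Z \<and> disjnt Z B1 \<and> disjnt Z B2" if "Z \<in> P - {B}" for Z
      using B_other[OF that] un by (auto simp: disjnt_def)
    have "disjnt B1 B2" "disjnt B2 B1" using dj by (auto simp: disjnt_def)
    then show "disjnt X Y" using XY old new by (elim insertE) simp_all
  qed
  moreover have "card ?P = Suc m"
  proof -
    have "B1 \<notin> P - {B}" "B2 \<notin> P - {B}" "B1 \<noteq> B2" using B_other ne un dj by blast+
    moreover have "card (P - {B}) = m - 1" using P(2) B by simp
    ultimately show ?thesis using finP Suc.hyps by simp
  qed
  moreover have "\<exists>b'. X = PiE I b' \<and> (\<forall>j\<in>I. b' j \<subseteq> c j \<and> b' j \<noteq> {})" if X: "X \<in> ?P" for X
  proof -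
    consider "X = B1" | "X = B2" | "X \<in> P" using X by auto
    then show ?thesis
    proof cases
      case 1
      then show ?thesis using b fj unfolding B1_def
        by (intro exI[of _ "b(j := {f j})"]) auto
    next
      case 2
      have "b j - {f j} \<noteq> {}" using fj j by auto
      then show ?thesis using b 2 unfolding B2_def
        by (intro exI[of _ "b(j := b j - {f j})"]) auto
    qed (use P(3) in auto)
  qed
  ultimately show ?case by blast
qed

text \<open>Counting is done fibre by fibre: a class \<open>k\<close> has a single value
  \<open>g' k\<close>, shared by its elements and by its pieces, so passing from elements to pieces
  loses exactly \<open>l k\<close> items of that fibre. This serves tails, heads and the total
  number of arcs alike.\<close>

lemma partition_refine_count:
  assumes K: "partition_on M K" and M: "finite M"
    and part: "\<And>k. k \<in> K \<Longrightarrow> partition_on k (part k)"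
    and w: "\<And>k. k \<in> K \<Longrightarrow> card (part k) + l k = card k"
    and g: "\<And>k x. k \<in> K \<Longrightarrow> x \<in> k \<Longrightarrow> g x = g' k"
    and h: "\<And>k B. k \<in> K \<Longrightarrow> B \<in> part k \<Longrightarrow> h B = g' k"
  shows "card {B \<in> \<Union>(part ` K). h B = v} + (\<Sum>k\<in>{k \<in> K. g' k = v}. l k) = card {x \<in> M. g x = v}"
proof -
  have finK: "finite K" using K M finite_elements by blast
  have fink: "finite k" if "k \<in> K" for k using K M that
    by (auto simp: partition_on_def intro: finite_subset)
  have finp: "finite (part k)" if "k \<in> K" for k using part[OF that] fink[OF that] finite_elements by blast
  have sub: "B \<subseteq> k" "B \<noteq> {}" if "k \<in> K" "B \<in> part k" for k B
    using part[OF that(1)] that by (auto simp: partition_on_def)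
  have disjK: "k \<inter> k' = {}" if "k \<in> K" "k' \<in> K" "k \<noteq> k'" for k k'
    using K that by (auto simp: partition_on_def disjoint_def)
  let ?K = "{k \<in> K. g' k = v}"
  have "{x \<in> M. g x = v} = \<Union>?K"
    using K g by (auto simp: partition_on_def)
  moreover have "disjoint ?K" using disjK by (auto simp: disjoint_def)
  then have "card (\<Union>?K) = (\<Sum>k\<in>?K. card k)" using fink by (rule card_Union_disjoint) simp
  ultimately have 1: "card {x \<in> M. g x = v} = (\<Sum>k\<in>?K. card k)" by simp
  have "{B \<in> \<Union>(part ` K). h B = v} = (\<Union>k\<in>?K. part k)" using h by auto
  moreover have "part k \<inter> part k' = {}" if "k \<in> K" "k' \<in> K" "k \<noteq> k'" for k k'
  proof (rule ccontr)
    assume "part k \<inter> part k' \<noteq> {}"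
    then obtain B where B: "B \<in> part k" "B \<in> part k'" by auto
    then have "B \<subseteq> k \<inter> k'" "B \<noteq> {}" using sub that by auto
    then show False using disjK[OF that] by simp
  qed
  ultimately have "card {B \<in> \<Union>(part ` K). h B = v} = (\<Sum>k\<in>?K. card (part k))"
    using finK finp by (simp add: card_UN_disjoint)
  then show ?thesis using 1 by (simp add: w flip: sum.distrib)
qed

lemma partition_on_refine:
  assumes "partition_on M K" and "\<And>k. k \<in> K \<Longrightarrow> partition_on k (part k)"
  shows "partition_on M (\<Union>(part ` K))"
proof (rule partition_onI)
  show "\<Union>(\<Union>(part ` K)) = M" using assms unfolding partition_on_def by fastforce
  show "{} \<notin> \<Union>(part ` K)" using assms(2) by (auto simp: partition_on_def)
next
  fix p p' assume "p \<in> \<Union>(part ` K)" "p' \<in> \<Union>(part ` K)" "p \<noteq> p'"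
  then obtain k k' where k: "k \<in> K" "p \<in> part k" "k' \<in> K" "p' \<in> part k'" by auto
  then have sub: "p \<subseteq> k" "p' \<subseteq> k'" using assms(2) by (auto simp: partition_on_def)
  show "disjnt p p'"
  proof (cases "k = k'")
    case True
    then show ?thesis using k assms(2)[of k] \<open>p \<noteq> p'\<close>
      by (auto simp: partition_on_def disjoint_def disjnt_def)
  next
    case False
    then have "k \<inter> k' = {}" using assms(1) k by (auto simp: partition_on_def disjoint_def)
    then show ?thesis using sub by (auto simp: disjnt_def)
  qed
qed

section \<open>Order relations and words for one row\<close>

text \<open>A vertex of the overlap graph is represented by order relations on the positions \<open>1, \<dots>, m\<close>,
  \<open>m = n - 1\<close>, so that no reduced forms are needed.\<close>

definition order_on :: "nat \<Rightarrow> (nat \<Rightarrow> nat) \<Rightarrow> (nat \<times> nat) set" where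
  "order_on m w = {(a, b). a \<in> {1..m} \<and> b \<in> {1..m} \<and> w a < w b}"

lemma mem_order_on: "(a, b) \<in> order_on m w \<longleftrightarrow> a \<in> {1..m} \<and> b \<in> {1..m} \<and> w a < w b"
  by (simp add: order_on_def)

lemma order_on_eq_iff:
  "order_on m v = order_on m w \<longleftrightarrow> (\<forall>a\<in>{1..m}. \<forall>b\<in>{1..m}. v a < v b \<longleftrightarrow> w a < w b)"
  unfolding set_eq_iff split_paired_All mem_order_on by blast

lemma order_on_cong: "(\<And>a. a \<in> {1..m} \<Longrightarrow> v a = w a) \<Longrightarrow> order_on m v = order_on m w"
  by (auto simp: order_on_def)

text \<open>Every value of a permutation is its own rank; consequently the order relation alone
  determines the permutation.\<close>

lemma permutes_eq_card:
  assumes p: "p permutes {1..m::nat}" and a: "a \<in> {1..m}"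
  shows "p a = card {b \<in> {1..m}. p b \<le> p a}"
proof -
  have "p ` {b \<in> {1..m}. p b \<le> p a} = {1..p a}"
  proof (intro equalityI subsetI)
    fix x assume x: "x \<in> {1..p a}"
    have "p a \<in> {1..m}" using p a by (simp only: permutes_in_image)
    then have "x \<in> p ` {1..m}" using x permutes_image[OF p] by auto
    then show "x \<in> p ` {b \<in> {1..m}. p b \<le> p a}" using x by auto
  next
    fix x assume "x \<in> p ` {b \<in> {1..m}. p b \<le> p a}"
    then show "x \<in> {1..p a}" using permutes_in_seg[OF p] by auto
  qed
  moreover have "inj_on p {b \<in> {1..m}. p b \<le> p a}" using p by (rule permutes_inj_on)
  ultimately show ?thesis using card_image by fastforce
qed

lemma permutes_eqI_order_on:
  assumes p: "p permutes {1..m}" and q: "q permutes {1..m}" and eq: "order_on m p = order_on m q"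
  shows "p = q"
proof
  fix a
  show "p a = q a"
  proof (cases "a \<in> {1..m}")
    case True
    have "{b \<in> {1..m}. p b \<le> p a} = {b \<in> {1..m}. q b \<le> q a}"
      using eq True unfolding order_on_eq_iff by (auto simp: not_less[symmetric])
    then show ?thesis using permutes_eq_card[OF p True] permutes_eq_card[OF q True] by simp
  next
    case False
    then show ?thesis using p q by (metis permutes_not_in)
  qed
qed

lemma permutesI_nat:
  assumes "inj_on p {1..m::nat}" "\<And>a. a \<in> {1..m} \<Longrightarrow> p a \<in> {1..m}" "\<And>a. a \<notin> {1..m} \<Longrightarrow> p a = a"
  shows "p permutes {1..m}"
proof (rule bij_imp_permutes)
  have "p ` {1..m} = {1..m}" using assms by (intro endo_inj_surj image_subsetI) simp_all
  then show "bij_betw p {1..m} {1..m}" using assms by (simp add: bij_betw_def)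
qed (use assms in auto)

text \<open>Replacing every entry by its rank gives the reduced form.\<close>

lemma standardization:
  assumes inj: "inj_on w {1..m}"
  obtains p where "p permutes {1..m}" "order_on m p = order_on m w"
proof
  define p where "p a = (if a \<in> {1..m} then card {b \<in> {1..m}. w b \<le> w a} else a)" for a
  have mono: "p a < p b" if ab: "a \<in> {1..m}" "b \<in> {1..m}" "w a < w b" for a b
  proof -
    have "b \<in> {c \<in> {1..m}. w c \<le> w b} - {c \<in> {1..m}. w c \<le> w a}" using ab by simp
    moreover have "{c \<in> {1..m}. w c \<le> w a} \<subseteq> {c \<in> {1..m}. w c \<le> w b}" using ab by auto
    ultimately have "{c \<in> {1..m}. w c \<le> w a} \<subset> {c \<in> {1..m}. w c \<le> w b}" by blast
    then show ?thesis using ab unfolding p_def by (simp add: psubset_card_mono)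
  qed
  have iff: "p a < p b \<longleftrightarrow> w a < w b" if "a \<in> {1..m}" "b \<in> {1..m}" for a b
    using mono that inj by (metis inj_onD less_asym linorder_neqE_nat less_irrefl)
  then show "order_on m p = order_on m w" by (simp add: order_on_eq_iff)
  show "p permutes {1..m}"
  proof (rule permutesI_nat)
    show "inj_on p {1..m}"
      using iff inj by (metis (no_types, lifting) inj_on_def less_irrefl linorder_neqE_nat)
    show "p a \<in> {1..m}" if a: "a \<in> {1..m}" for a
    proof -
      have "card {b \<in> {1..m}. w b \<le> w a} \<le> card {1..m}" by (intro card_mono) auto
      moreover have "card {b \<in> {1..m}. w b \<le> w a} > 0" using a by (auto simp: card_gt_0_iff)
      ultimately show ?thesis using a by (auto simp: p_def)
    qed
  qed (auto simp: p_def)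
qed

section \<open>Permutations encoded by one row of a window\<close>

definition encoded :: "nat \<Rightarrow> (nat \<Rightarrow> nat) \<Rightarrow> (nat \<Rightarrow> nat) set" where
  "encoded m w = {p. p permutes {1..m} \<and> order_on m w \<subseteq> order_on m p}"

text \<open>The order of a permutation is total, and a strict total order cannot be properly
  extended to another strict order.\<close>

lemma encoded_distinct:
  assumes p: "p permutes {1..m}" and eq: "order_on m w = order_on m p"
  shows "encoded m w = {p}"
proof -
  have "q = p" if q: "q permutes {1..m}" "order_on m p \<subseteq> order_on m q" for q
  proof -
    have "order_on m q \<subseteq> order_on m p"
    proof clarify
      fix a b assume "(a, b) \<in> order_on m q"
      then have ab: "a \<in> {1..m}" "b \<in> {1..m}" "q a < q b" by (auto simp: order_on_def)
      then have "a \<noteq> b" by auto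
      then have "p a \<noteq> p b" using inj_eq[OF permutes_inj[OF p]] by simp
      moreover have "\<not> p b < p a"
      proof
        assume "p b < p a"
        then have "(b, a) \<in> order_on m p" using ab(1,2) mem_order_on by blast
        then have "q b < q a" using q(2) mem_order_on by blast
        then show False using ab(3) by simp
      qed
      ultimately show "(a, b) \<in> order_on m p" using ab by (auto simp: order_on_def)
    qed
    then show ?thesis using q p permutes_eqI_order_on by blast
  qed
  then show ?thesis using p eq by (auto simp: encoded_def)
qed

abbreviation swap_ends :: "nat \<Rightarrow> nat \<Rightarrow> nat" where
  "swap_ends m \<equiv> Transposition.transpose 1 (Suc m)"

lemma swap_ends_simps:
  "swap_ends m 1 = Suc m" "swap_ends m (Suc m) = 1"
  "a \<in> {1..Suc m} \<Longrightarrow> a \<noteq> 1 \<Longrightarrow> a \<noteq> Suc m \<Longrightarrow> swap_ends m a = a"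
  by (auto simp: transpose_apply_other)

text \<open>No value lies strictly between the two adjacent end values, so every other letter
  compares with both ends in the same way. The exchange reverses only the comparison of the ends
  with each other.\<close>

lemma swap_ends_less_iff:
  assumes p: "p permutes {1..Suc m}" and adj: "p (Suc m) = Suc (p 1)"
    and ab: "a \<in> {1..Suc m}" "b \<in> {1..Suc m}" "{a, b} \<noteq> {1, Suc m}"
  shows "p (swap_ends m a) < p (swap_ends m b) \<longleftrightarrow> p a < p b"
proof -
  have inj: "p x = p y \<longleftrightarrow> x = y" for x y using permutes_inj[OF p] by (auto dest: injD)
  have other: "p (swap_ends m x) = p x" "p x \<noteq> p 1" "p x \<noteq> Suc (p 1)"
    if "x \<in> {1..Suc m}" "x \<notin> {1, Suc m}" for x
    using that inj[of x 1] inj[of x "Suc m"] adj swap_ends_simps(3)[of x m] by auto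
  have ends: "p (swap_ends m x) \<in> {p 1, Suc (p 1)}" "p x \<in> {p 1, Suc (p 1)}"
    if "x \<in> {1, Suc m}" for x
    using that adj swap_ends_simps(1,2)[of m] by auto
  have "a = b" if "a \<in> {1, Suc m}" "b \<in> {1, Suc m}" using that ab(3) by auto
  then show ?thesis
    using other[OF ab(1)] other[OF ab(2)] ends[of a] ends[of b]
    by (cases "a \<in> {1, Suc m}"; cases "b \<in> {1, Suc m}") auto
qed

text \<open>Neither the first \<open>m\<close> nor the last \<open>m\<close> positions contain both
  ends, so the two permutations are parallel arcs of the overlap graph.\<close>

lemma swap_ends_order_on:
  assumes p: "p permutes {1..Suc m}" and adj: "p (Suc m) = Suc (p 1)"
  shows "order_on m (p \<circ> swap_ends m) = order_on m p"
    and "order_on m (p \<circ> swap_ends m \<circ> Suc) = order_on m (p \<circ> Suc)"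
  using swap_ends_less_iff[OF assms] unfolding order_on_eq_iff
  by (auto simp: doubleton_eq_iff)

lemma swap_ends_permutes:
  "p permutes {1..Suc m} \<Longrightarrow> p \<circ> swap_ends m permutes {1..Suc m}"
  by (intro permutes_compose permutes_swap_id) auto

text \<open>\<open>w\<close> and \<open>p\<close> agree on every comparison except that of the ends,
  where \<open>w\<close> is tied. A linear extension is thus determined by how it orders the
  ends.\<close>

lemma encoded_tied_ends:
  assumes p: "p permutes {1..Suc m}" and adj: "p (Suc m) = Suc (p 1)"
    and tie: "w (Suc m) = w 1" and ord: "order_on m w = order_on m p"
  shows "encoded (Suc m) w = {p, p \<circ> swap_ends m}"
proof -
  let ?n = "Suc m"
  have inj: "p x = p y \<longleftrightarrow> x = y" for x y using permutes_inj[OF p] by (auto dest: injD)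
  have m: "m \<ge> 1" using adj by (cases m) auto
  have w: "w a < w b \<longleftrightarrow> p a < p b" if asm: "a \<in> {1..?n}" "b \<in> {1..?n}" "{a, b} \<noteq> {1, ?n}" for a b
  proof -
    have ord': "w a < w b \<longleftrightarrow> p a < p b" if "a \<in> {1..m}" "b \<in> {1..m}" for a b
      using ord that unfolding order_on_eq_iff by blast
    \<comment> \<open>Inner letters avoid both end values, so their comparisons with the last letter
      can be read off those with the first.\<close>
    have *: "p x \<noteq> p 1 \<and> p x \<noteq> Suc (p 1)" if "x \<noteq> 1" "x \<noteq> ?n" for x
      using that inj[of x 1] inj[of x ?n] adj by auto
    consider "a \<le> m" "b \<le> m" | "a = ?n" "b = ?n" | "a = ?n" "b \<le> m" "b \<noteq> 1" | "b = ?n" "a \<le> m" "a \<noteq> 1"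
      using asm by (auto simp: doubleton_eq_iff le_Suc_eq)
    then show ?thesis
    proof cases
      case 3
      then show ?thesis using asm ord'[of 1 b] m tie adj *[of b] by auto
    next
      case 4
      then show ?thesis using asm ord'[of a 1] m tie adj *[of a] by auto
    qed (use asm ord' in auto)
  qed
  have tie': "\<not> w a < w b" if "{a, b} = {1, ?n}" for a b
    using that tie by (auto simp: doubleton_eq_iff)
  have swap: "p \<circ> swap_ends m permutes {1..?n}" using p by (rule swap_ends_permutes)
  show ?thesis
  proof (intro equalityI subsetI)
    fix q assume "q \<in> {p, p \<circ> swap_ends m}"
    moreover have "order_on ?n w \<subseteq> order_on ?n p \<inter> order_on ?n (p \<circ> swap_ends m)"
    proof clarify
      fix a b assume "(a, b) \<in> order_on ?n w"
      then have ab: "a \<in> {1..?n}" "b \<in> {1..?n}" "w a < w b" unfolding mem_order_on by auto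
      then have "{a, b} \<noteq> {1, ?n}" using tie' by blast
      then show "(a, b) \<in> order_on ?n p \<inter> order_on ?n (p \<circ> swap_ends m)"
        unfolding Int_iff mem_order_on o_apply
        using ab w[of a b] swap_ends_less_iff[OF p adj, of a b] by blast
    qed
    ultimately show "q \<in> encoded ?n w" using p swap by (auto simp only: encoded_def)
  next
    fix q assume "q \<in> encoded ?n w"
    then have q: "q permutes {1..?n}"
      and qw: "\<And>a b. a \<in> {1..?n} \<Longrightarrow> b \<in> {1..?n} \<Longrightarrow> w a < w b \<Longrightarrow> q a < q b"
      by (auto simp: encoded_def order_on_def)
    have qp: "q a < q b" if "a \<in> {1..?n}" "b \<in> {1..?n}" "{a, b} \<noteq> {1, ?n}" "p a < p b" for a b
      using qw w that by blast
    have "q 1 \<noteq> q ?n" using permutes_inj[OF q] m by (auto dest: injD)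
    then consider "q 1 < q ?n" | "q ?n < q 1" by linarith
    then show "q \<in> {p, p \<circ> swap_ends m}"
    proof cases
      case 1
      have "order_on ?n p \<subseteq> order_on ?n q"
        using qp 1 adj by (fastforce simp: order_on_def doubleton_eq_iff)
      then have "q \<in> encoded ?n p" using q by (simp add: encoded_def)
      then show ?thesis using encoded_distinct[OF p refl] by simp
    next
      case 2
      have "order_on ?n (p \<circ> swap_ends m) \<subseteq> order_on ?n q"
      proof clarify
        fix a b assume "(a, b) \<in> order_on ?n (p \<circ> swap_ends m)"
        then have ab: "a \<in> {1..?n}" "b \<in> {1..?n}" "p (swap_ends m a) < p (swap_ends m b)"
          by (auto simp: order_on_def)
        show "(a, b) \<in> order_on ?n q"
        proof (cases "{a, b} = {1, ?n}")
          case True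
          then show ?thesis using ab 2 adj
            by (auto simp: order_on_def doubleton_eq_iff)
        next
          case False
          then show ?thesis using ab qp swap_ends_less_iff[OF p adj] by (auto simp: order_on_def)
        qed
      qed
      then have "q \<in> encoded ?n (p \<circ> swap_ends m)" using q by (simp add: encoded_def)
      then show ?thesis using encoded_distinct[OF swap refl] by simp
    qed
  qed
qed

text \<open>The sets of permutations of length \<open>m + 1\<close> encoded by one row of a window in which at most
  the first and the last entries coincide.\<close>

definition row_blocks :: "nat \<Rightarrow> (nat \<Rightarrow> nat) set set" where
  "row_blocks m = {\<beta>. \<exists>p. p permutes {1..Suc m} \<and>
     (\<beta> = {p} \<or> p (Suc m) = Suc (p 1) \<and> \<beta> = {p, p \<circ> swap_ends m})}"

lemma encoded_cong:
  assumes "\<And>a. a \<in> {1..m} \<Longrightarrow> v a = w a" shows "encoded m v = encoded m w"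
  using order_on_cong[of m v w] assms by (simp add: encoded_def)

text \<open>Doubling the old entries leaves odd numbers free for the new one.\<close>

lemma row_word_step:
  assumes \<beta>: "\<beta> \<in> row_blocks m"
    and tl: "\<And>p. p \<in> \<beta> \<Longrightarrow> order_on m p = order_on m w"
    and pos: "\<And>a. a \<in> {1..m} \<Longrightarrow> 0 < w a" and m: "m \<ge> 1"
  obtains x where "0 < x" "encoded (Suc m) ((\<lambda>a. 2 * w a)(Suc m := x)) = \<beta>"
    "\<And>p. p \<in> \<beta> \<Longrightarrow> order_on m ((\<lambda>a. 2 * w a)(Suc m := x) \<circ> Suc) = order_on m (p \<circ> Suc)"
proof -
  obtain p where p: "p permutes {1..Suc m}"
    "\<beta> = {p} \<or> p (Suc m) = Suc (p 1) \<and> \<beta> = {p, p \<circ> swap_ends m}"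
    using \<beta> by (auto simp: row_blocks_def)
  have inj: "p x = p y \<longleftrightarrow> x = y" for x y using permutes_inj[OF p(1)] by (auto dest: injD)
  have wp: "w a < w b \<longleftrightarrow> p a < p b" if "a \<in> {1..m}" "b \<in> {1..m}" for a b
    using tl[of p] p(2) that unfolding order_on_eq_iff by auto
  show thesis
  proof (cases "\<beta> = {p}")
    case True
    \<comment> \<open>\<open>M\<close> is the largest old entry that has to stay below the new
      letter. The extra 0 covers the case that there is none; positivity of \<open>w\<close> then
      keeps all old entries above the new one.\<close>
    define M where "M = Max (insert 0 (w ` {a \<in> {1..m}. p a < p (Suc m)}))"
    have fin: "finite (insert 0 (w ` {a \<in> {1..m}. p a < p (Suc m)}))" by simp
    have lo: "w a \<le> M" if "a \<in> {1..m}" "p a < p (Suc m)" for a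
      unfolding M_def by (intro Max_ge[OF fin]) (use that in auto)
    have hi: "M < w a" if "a \<in> {1..m}" "\<not> p a < p (Suc m)" for a
    proof -
      have "p a > p (Suc m)" using that inj[of a "Suc m"] by auto
      then show ?thesis using that pos wp unfolding M_def
        by (subst Max_less_iff[OF fin]) (auto intro: less_trans)
    qed
    define x where "x = 2 * M + 1"
    define v where "v = (\<lambda>a. 2 * w a)(Suc m := x)"
    have lo': "v a < x" if "a \<in> {1..m}" "p a < p (Suc m)" for a
      using lo[OF that] that by (auto simp: v_def x_def)
    have hi': "x < v a" if "a \<in> {1..m}" "\<not> p a < p (Suc m)" for a
      using hi[OF that] that by (auto simp: v_def x_def)
    have v: "v a < v b \<longleftrightarrow> p a < p b" if asm: "a \<in> {1..Suc m}" "b \<in> {1..Suc m}" for a b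
    proof -
      have vx: "v (Suc m) = x" and vo: "\<And>a. a \<in> {1..m} \<Longrightarrow> v a = 2 * w a" by (auto simp: v_def)
      consider "a \<in> {1..m}" "b \<in> {1..m}" | "a = Suc m" "b = Suc m"
        | "a = Suc m" "b \<in> {1..m}" | "b = Suc m" "a \<in> {1..m}"
        using asm by (auto simp: le_Suc_eq)
      then show ?thesis
      proof cases
        case 1
        then show ?thesis by (simp add: vo wp)
      next
        case 3
        then show ?thesis using lo'[of b] hi'[of b] vx inj[of b "Suc m"] by (cases "p b < p (Suc m)") auto
      next
        case 4
        then show ?thesis using lo'[of a] hi'[of a] vx by (cases "p a < p (Suc m)") auto
      qed auto
    qed
    have "order_on (Suc m) v = order_on (Suc m) p" using v by (simp add: order_on_eq_iff)
    moreover from this have "order_on m (v \<circ> Suc) = order_on m (p \<circ> Suc)"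
      by (simp add: order_on_eq_iff)
    ultimately show thesis using that[of x] encoded_distinct[OF p(1), of v] True
      by (simp add: x_def v_def)
  next
    case False
    then have dbl: "p (Suc m) = Suc (p 1)" "\<beta> = {p, p \<circ> swap_ends m}" using p by auto
    \<comment> \<open>For a pair, the new letter repeats the first letter of the window, which
      creates the tie.\<close>
    define v where "v = (\<lambda>a. 2 * w a)(Suc m := 2 * w 1)"
    have v: "order_on m v = order_on m p"
      using wp by (auto simp: order_on_eq_iff v_def)
    have "encoded (Suc m) v = \<beta>"
      unfolding dbl(2) using m v by (intro encoded_tied_ends p dbl) (auto simp: v_def)
    moreover have "order_on m (v \<circ> Suc) = order_on m (p \<circ> Suc)"
    proof -
      have *: "p x \<noteq> p 1 \<and> p x \<noteq> Suc (p 1)" if "x \<noteq> 1" "x \<noteq> Suc m" for x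
        using that inj[of x 1] inj[of x "Suc m"] dbl(1) by auto
      have "v (Suc a) < v (Suc b) \<longleftrightarrow> p (Suc a) < p (Suc b)" if "a \<in> {1..m}" "b \<in> {1..m}" for a b
        using that wp[of "Suc a" "Suc b"] wp[of "Suc a" 1] wp[of 1 "Suc b"] *[of "Suc a"] *[of "Suc b"] dbl(1) m
        by (cases "a = m"; cases "b = m") (auto simp: v_def)
      then show ?thesis by (simp add: order_on_eq_iff)
    qed
    moreover have "order_on m (q \<circ> Suc) = order_on m (p \<circ> Suc)" if "q \<in> \<beta>" for q
      using that swap_ends_order_on(2)[OF p(1) dbl(1)] unfolding dbl(2) by blast
    ultimately show thesis using that[of "2 * w 1"] pos[of 1] m by (simp add: v_def)
  qed
qed

text \<open>The word grows by one letter per block. The invariant is that its last \<open>m\<close>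
  letters have the pattern that the next block requires as its tail.\<close>

lemma row_word:
  assumes \<beta>: "\<And>k. k < N \<Longrightarrow> \<beta> k \<in> row_blocks m"
    and tl: "\<And>k p. k < N \<Longrightarrow> p \<in> \<beta> k \<Longrightarrow> order_on m p = v k"
    and hd: "\<And>k p. k < N \<Longrightarrow> p \<in> \<beta> k \<Longrightarrow> order_on m (p \<circ> Suc) = v (Suc k)"
    and N: "N \<ge> 1" and m: "m \<ge> 1"
  shows "\<exists>u :: nat \<Rightarrow> nat. (\<forall>c. 0 < u c) \<and> (\<forall>k<N. encoded (Suc m) (\<lambda>a. u (k + a)) = \<beta> k)"
proof -
  have "\<exists>u :: nat \<Rightarrow> nat. (\<forall>c. 0 < u c) \<and> (\<forall>k<N'. encoded (Suc m) (\<lambda>a. u (k + a)) = \<beta> k) \<and>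
      order_on m (\<lambda>a. u (N' + a)) = v N'" if "N' \<le> N" for N'
    using that
  proof (induction N')
    case 0
    \<comment> \<open>Any member of the first block supplies the initial letters. Adding 1 makes
      every column positive, including column 0, which \<open>p\<close> fixes.\<close>
    obtain p where p: "p \<in> \<beta> 0" "p permutes {1..Suc m}"
      using \<beta>[of 0] N by (auto simp: row_blocks_def)
    have "order_on m (\<lambda>a. Suc (p a)) = v 0"
      using tl[of 0 p] p N by (auto simp: order_on_def)
    then show ?case by (intro exI[of _ "\<lambda>a. Suc (p a)"]) auto
  next
    case (Suc k)
    then obtain u :: "nat \<Rightarrow> nat" where u: "\<And>c. 0 < u c"
      "\<And>i. i < k \<Longrightarrow> encoded (Suc m) (\<lambda>a. u (i + a)) = \<beta> i" "order_on m (\<lambda>a. u (k + a)) = v k"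
      by auto
    have k: "k < N" using Suc by simp
    obtain x where x: "0 < x" "encoded (Suc m) ((\<lambda>a. 2 * u (k + a))(Suc m := x)) = \<beta> k"
      "\<And>p. p \<in> \<beta> k \<Longrightarrow>
        order_on m ((\<lambda>a. 2 * u (k + a))(Suc m := x) \<circ> Suc) = order_on m (p \<circ> Suc)"
      by (rule row_word_step[OF \<beta>[OF k], of "\<lambda>a. u (k + a)"]) (use tl[OF k] u m in auto)
    define u' where "u' = (\<lambda>c. 2 * u c)(Suc (k + m) := x)"
    have pos: "0 < u' c" for c using u x by (simp add: u'_def)
    have eq: "(\<lambda>a. u' (k + a)) = (\<lambda>a. 2 * u (k + a))(Suc m := x)"
      by (auto simp: u'_def fun_eq_iff)
    have old: "encoded (Suc m) (\<lambda>a. u' (i + a)) = \<beta> i" if i: "i < k" for i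
    proof -
      \<comment> \<open>An earlier window ends before the new column, and doubling preserves its
        comparisons.\<close>
      have "encoded (Suc m) (\<lambda>a. u' (i + a)) = encoded (Suc m) (\<lambda>a. 2 * u (i + a))"
        using i by (intro encoded_cong) (auto simp: u'_def)
      also have "\<dots> = encoded (Suc m) (\<lambda>a. u (i + a))"
        by (simp add: encoded_def order_on_def)
      finally show ?thesis using u(2) i by simp
    qed
    obtain p where p: "p \<in> \<beta> k" using \<beta>[OF k] by (auto simp: row_blocks_def)
    have "order_on m (\<lambda>a. u' (Suc k + a)) = order_on m ((\<lambda>a. u' (k + a)) \<circ> Suc)"
      by (simp add: o_def)
    also have "\<dots> = v (Suc k)" unfolding eq using x(3)[OF p] hd[OF k p] by simp
    finally have "order_on m (\<lambda>a. u' (Suc k + a)) = v (Suc k)" .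
    then show ?case using pos old x(2) eq by (intro exI[of _ u']) (auto simp: less_Suc_eq)
  qed
  then show ?thesis using le_refl by blast
qed

section \<open>Classes of parallel arcs in one row\<close>

text \<open>Composition on the right with \<open>cyc m\<close> rotates the one-line notation by one
  place, the first letter becoming the last.\<close>

definition cyc :: "nat \<Rightarrow> nat \<Rightarrow> nat" where
  "cyc m a = (if a \<in> {1..m} then if a = m then 1 else Suc a else a)"

definition descending :: "nat \<Rightarrow> nat \<Rightarrow> nat" where
  "descending m a = (if a \<in> {1..m} then Suc m - a else a)"

text \<open>Extends the pattern \<open>q\<close> by a last letter whose value is the successor of the first letter.\<close>

definition lift_tie :: "nat \<Rightarrow> (nat \<Rightarrow> nat) \<Rightarrow> nat \<Rightarrow> nat" where
  "lift_tie m q a = (if a = Suc m then Suc (q 1)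
     else if a \<in> {1..m} then if q a \<le> q 1 then q a else Suc (q a) else a)"

lemma cyc_permutes: "cyc m permutes {1..m}"
  by (rule permutesI_nat) (auto simp: cyc_def inj_on_def)

lemma funpow_cyc:
  assumes "x < m" shows "(cyc m ^^ k) (Suc x) = Suc ((x + k) mod m)"
proof (induction k)
  case (Suc k)
  have "cyc m (Suc y) = Suc (Suc y mod m)" if "y < m" for y
    using that by (auto simp: cyc_def)
  then have "cyc m (Suc ((x + k) mod m)) = Suc ((x + Suc k) mod m)"
    using assms by (simp add: mod_Suc_eq)
  then show ?case using Suc by simp
qed (use assms in simp)

lemma funpow_cyc_self: "cyc m ^^ m = id"
proof
  fix a
  show "(cyc m ^^ m) a = id a"
  proof (cases "a \<in> {1..m}")
    case True
    then obtain x where "a = Suc x" "x < m" by (cases a) auto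
    then show ?thesis by (simp add: funpow_cyc)
  next
    case False
    have "(cyc m ^^ k) a = a" for k using False by (induction k) (auto simp: cyc_def)
    then show ?thesis by simp
  qed
qed

lemma descending_permutes: "descending m permutes {1..m}"
  by (rule permutesI_nat) (auto simp: descending_def inj_on_def)

lemma lift_tie_less_iff:
  assumes "q permutes {1..m}" "a \<in> {1..m}" "b \<in> {1..m}"
  shows "lift_tie m q a < lift_tie m q b \<longleftrightarrow> q a < q b"
  using assms by (auto simp: lift_tie_def)

lemma lift_tie_ends:
  assumes "m \<ge> 1" shows "lift_tie m q (Suc m) = Suc (lift_tie m q 1)"
  using assms by (auto simp: lift_tie_def)

lemma lift_tie_permutes:
  assumes q: "q permutes {1..m}" and m: "m \<ge> 1"
  shows "lift_tie m q permutes {1..Suc m}"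
proof (rule permutesI_nat)
  have inj: "q x = q y \<longleftrightarrow> x = y" for x y using permutes_inj[OF q] by (auto dest: injD)
  show "inj_on (lift_tie m q) {1..Suc m}"
    by (rule inj_onI) (auto simp: lift_tie_def inj le_Suc_eq split: if_splits)
  show "lift_tie m q a \<in> {1..Suc m}" if "a \<in> {1..Suc m}" for a
    using that permutes_in_seg[OF q, of a] permutes_in_seg[OF q, of 1] m
    by (auto simp: lift_tie_def)
qed (auto simp: lift_tie_def)

text \<open>The last letter exceeds the first by one, hence compares with the letters in between as
  the first one does. Dropping the first letter therefore leaves the cyclic shift.\<close>

lemma lift_tie_order_on:
  assumes q: "q permutes {1..m}" and m: "m \<ge> 1"
  shows "order_on m (lift_tie m q) = order_on m q"
    and "order_on m (lift_tie m q \<circ> Suc) = order_on m (q \<circ> cyc m)"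
proof -
  show "order_on m (lift_tie m q) = order_on m q"
    using lift_tie_less_iff[OF q] by (simp add: order_on_eq_iff)
  have inj: "q x = q y \<longleftrightarrow> x = y" for x y using permutes_inj[OF q] by (auto dest: injD)
  show "order_on m (lift_tie m q \<circ> Suc) = order_on m (q \<circ> cyc m)"
    unfolding order_on_eq_iff
  proof (intro ballI)
    fix a b assume "a \<in> {1..m}" "b \<in> {1..m}"
    then show "(lift_tie m q \<circ> Suc) a < (lift_tie m q \<circ> Suc) b \<longleftrightarrow> (q \<circ> cyc m) a < (q \<circ> cyc m) b"
      using inj[of "Suc a" 1] inj[of "Suc b" 1] by (auto simp: lift_tie_def cyc_def)
  qed
qed

text \<open>In one row, \<open>Asc\<close> and \<open>Desc\<close> are the two loops of the overlap graph, and \<open>Tie q\<close> is the pair of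
  parallel arcs from \<open>q\<close> to its cyclic shift.\<close>

datatype row_class = Asc | Desc | Tie "nat \<Rightarrow> nat"

definition row_classes :: "nat \<Rightarrow> row_class set" where
  "row_classes m = {Asc, Desc} \<union> Tie ` {q. q permutes {1..m}}"

fun row_box :: "nat \<Rightarrow> row_class \<Rightarrow> (nat \<Rightarrow> nat) set" where
  "row_box m Asc = {id}"
| "row_box m Desc = {descending (Suc m)}"
| "row_box m (Tie q) = {lift_tie m q, lift_tie m q \<circ> swap_ends m}"

fun shift :: "nat \<Rightarrow> row_class \<Rightarrow> row_class" where
  "shift m Asc = Asc"
| "shift m Desc = Desc"
| "shift m (Tie q) = Tie (q \<circ> cyc m)"

fun row_tail :: "nat \<Rightarrow> row_class \<Rightarrow> (nat \<times> nat) set" where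
  "row_tail m Asc = order_on m id"
| "row_tail m Desc = order_on m (descending (Suc m))"
| "row_tail m (Tie q) = order_on m q"

lemma row_box_permutes:
  assumes "r \<in> row_classes m" "m \<ge> 1" "p \<in> row_box m r"
  shows "p permutes {1..Suc m}"
  using assms lift_tie_permutes swap_ends_permutes descending_permutes permutes_id
  by (auto simp: row_classes_def simp del: o_apply)

text \<open>Monotone rows are loops because all their factors of length \<open>m\<close> have the
  same pattern; a \<open>Tie\<close> moves on to its rotation. Writing heads as tails of the shifted
  class is what turns invariance under \<open>shift\<close> into balance.\<close>

lemma row_box_order_on:
  assumes r: "r \<in> row_classes m" and m: "m \<ge> 1" and p: "p \<in> row_box m r"
  shows "order_on m p = row_tail m r" "order_on m (p \<circ> Suc) = row_tail m (shift m r)"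
proof -
  have "order_on m p = row_tail m r \<and> order_on m (p \<circ> Suc) = row_tail m (shift m r)"
  proof (cases r)
    case (Tie q)
    then have q: "q permutes {1..m}" using r by (auto simp: row_classes_def)
    note ends = lift_tie_permutes[OF q m] lift_tie_ends[OF m]
    show ?thesis using p lift_tie_order_on[OF q m] swap_ends_order_on[OF ends] unfolding Tie
      by (simp only: row_box.simps row_tail.simps shift.simps) auto
  qed (use p in \<open>auto simp: order_on_eq_iff descending_def\<close>)
  then show "order_on m p = row_tail m r" "order_on m (p \<circ> Suc) = row_tail m (shift m r)" by auto
qed

text \<open>The end values differ by 1 for a \<open>Tie\<close> but by \<open>m\<close> for the
  monotone rows, which \<open>m \<ge> 2\<close> separates. The pattern of a \<open>Tie\<close> is
  recovered from the order of the first \<open>m\<close> letters.\<close>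

lemma row_box_disjoint:
  assumes r: "r \<in> row_classes m" "r' \<in> row_classes m" and m: "m \<ge> 2"
    and p: "p \<in> row_box m r" "p \<in> row_box m r'"
  shows "r = r'"
proof -
  have tie: "p 1 = Suc (p (Suc m)) \<or> p (Suc m) = Suc (p 1)" if "p \<in> row_box m (Tie q)" for q
    using that lift_tie_ends[of m q] m swap_ends_simps(1,2)[of m] by auto
  have asc: "p 1 = 1 \<and> p (Suc m) = Suc m" if "p \<in> row_box m Asc"
    using that by simp
  have desc: "p 1 = Suc m \<and> p (Suc m) = 1" if "p \<in> row_box m Desc"
    using that by (simp add: descending_def)
  show ?thesis
  proof (cases r; cases r')
    fix q q' assume q: "r = Tie q" "r' = Tie q'"
    then have "q permutes {1..m}" "q' permutes {1..m}" using r by (auto simp: row_classes_def)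
    moreover have "order_on m q = order_on m q'"
      using row_box_order_on(1)[OF r(1) _ p(1)] row_box_order_on(1)[OF r(2) _ p(2)] m q by simp
    ultimately show ?thesis using permutes_eqI_order_on q by blast
  qed (use p m tie asc desc in force)+
qed

lemma card_row_box:
  "m \<ge> 1 \<Longrightarrow> card (row_box m r) = (case r of Tie q \<Rightarrow> 2 | _ \<Rightarrow> 1)"
proof (cases r)
  case (Tie q)
  assume m: "m \<ge> 1"
  then have "lift_tie m q 1 \<noteq> (lift_tie m q \<circ> swap_ends m) 1"
    using lift_tie_ends[OF m, of q] swap_ends_simps(1)[of m] by simp
  then have "lift_tie m q \<noteq> lift_tie m q \<circ> swap_ends m" by metis
  then show ?thesis using Tie by simp
qed auto

lemma row_box_nonempty: "row_box m r \<noteq> {}"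
  by (cases r) auto

lemma finite_row_box: "finite (row_box m r)"
  by (cases r) auto

text \<open>A nonempty subset of a set with at most two elements is a singleton or everything. Hence
  every sub-box produced by splitting can still be spelled row by row.\<close>

lemma row_box_subset_row_blocks:
  assumes r: "r \<in> row_classes m" and m: "m \<ge> 1" and b: "b \<subseteq> row_box m r" "b \<noteq> {}"
  shows "b \<in> row_blocks m"
proof (cases "\<exists>p. b = {p}")
  case True
  then show ?thesis using b row_box_permutes[OF r m] by (auto simp: row_blocks_def)
next
  case False
  then obtain q where q: "r = Tie q" using b by (cases r) (auto dest: subset_singletonD)
  then have "b = row_box m r" using b False by auto
  moreover have "q permutes {1..m}" using r q by (auto simp: row_classes_def)
  ultimately show ?thesis using q lift_tie_permutes[of q m] lift_tie_ends[OF m, of q] m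
    unfolding row_blocks_def by auto
qed

lemma finite_row_classes: "finite (row_classes m)"
  by (simp add: row_classes_def finite_permutations)

lemma card_row_classes: "card (row_classes m) = 2 + fact m"
proof -
  have "card (Tie ` {q. q permutes {1..m}}) = fact m"
    by (subst card_image) (auto simp: inj_on_def card_permutations)
  moreover have "row_classes m = insert Asc (insert Desc (Tie ` {q. q permutes {1..m}}))"
    by (simp add: row_classes_def)
  ultimately show ?thesis by (simp add: finite_permutations image_iff)
qed

lemma sum_card_row_box:
  assumes "m \<ge> 1" shows "(\<Sum>r\<in>row_classes m. card (row_box m r)) = 2 + 2 * fact m"
proof -
  let ?Q = "{q. q permutes {1..m}}"
  have "(\<Sum>r\<in>Tie ` ?Q. card (row_box m r)) = (\<Sum>q\<in>?Q. 2)"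
    using card_row_box[OF assms] by (subst sum.reindex) (auto simp: inj_on_def)
  also have "\<dots> = 2 * fact m" by (simp add: card_permutations)
  finally have "(\<Sum>r\<in>Tie ` ?Q. card (row_box m r)) = 2 * fact m" .
  moreover have "row_classes m = insert Asc (insert Desc (Tie ` ?Q))"
    by (simp add: row_classes_def)
  ultimately show ?thesis by (simp add: finite_permutations image_iff)
qed

lemma bij_betw_comp_permutation:
  assumes c: "c permutes S"
  shows "bij_betw (\<lambda>q. q \<circ> c) {q. q permutes S} {q. q permutes S}"
proof (rule bij_betw_byWitness[where f' = "\<lambda>q. q \<circ> inv c"])
  show "\<forall>q\<in>{q. q permutes S}. q \<circ> c \<circ> inv c = q" using permutes_inv_o(1)[OF c] by (simp add: o_assoc[symmetric])
  show "\<forall>q\<in>{q. q permutes S}. q \<circ> inv c \<circ> c = q" using permutes_inv_o(2)[OF c] by (simp add: o_assoc[symmetric])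
  show "(\<lambda>q. q \<circ> c) ` {q. q permutes S} \<subseteq> {q. q permutes S}"
    using permutes_compose[OF c] by auto
  show "(\<lambda>q. q \<circ> inv c) ` {q. q permutes S} \<subseteq> {q. q permutes S}"
    using permutes_compose[OF permutes_inv[OF c]] by auto
qed

lemma bij_betw_shift: "bij_betw (shift m) (row_classes m) (row_classes m)"
proof -
  let ?Q = "{q. q permutes {1..m}}"
  have Q: "(\<lambda>q. q \<circ> cyc m) ` ?Q = ?Q" "inj_on (\<lambda>q. q \<circ> cyc m) ?Q"
    using bij_betw_comp_permutation[OF cyc_permutes[of m]] by (simp_all add: bij_betw_def)
  have "shift m ` Tie ` ?Q = Tie ` (\<lambda>q. q \<circ> cyc m) ` ?Q" by (simp only: image_image shift.simps)
  then have "shift m ` row_classes m = row_classes m"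
    unfolding Q(1) by (simp add: row_classes_def image_Un)
  moreover have "inj_on (shift m) (row_classes m)"
    using Q(2) by (auto simp: row_classes_def inj_on_def simp del: o_apply)
  ultimately show ?thesis by (simp add: bij_betw_def)
qed

lemma card_row_box_shift: "card (row_box m (shift m r)) = card (row_box m r)" if "m \<ge> 1"
  using card_row_box[OF that] by (cases r) (simp_all del: row_box.simps)

lemma funpow_shift_Tie: "(shift m ^^ k) (Tie q) = Tie (q \<circ> (cyc m ^^ k))"
proof (induction k)
  case (Suc k)
  have "q \<circ> (cyc m ^^ k) \<circ> cyc m = q \<circ> (cyc m ^^ Suc k)"
    by (simp only: funpow_Suc_right o_assoc)
  then show ?case using Suc by (simp only: funpow.simps o_apply[where f = "shift m"] shift.simps)
qed simp

lemma funpow_shift_self: "(shift m ^^ m) r = r"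
proof (cases r)
  case (Tie q)
  then show ?thesis by (simp add: funpow_shift_Tie funpow_cyc_self)
next
  case Asc
  have "(shift m ^^ k) Asc = Asc" for k by (induction k) auto
  then show ?thesis using Asc by simp
next
  case Desc
  have "(shift m ^^ k) Desc = Desc" for k by (induction k) auto
  then show ?thesis using Desc by simp
qed

text \<open>The letters of \<open>q\<close> are distinct, and a rotation by fewer than
  \<open>m\<close> places brings a different letter to the first position.\<close>

lemma funpow_shift_neq:
  assumes q: "q permutes {1..m}" and k: "0 < k" "k < m"
  shows "(shift m ^^ k) (Tie q) \<noteq> Tie q"
proof
  assume "(shift m ^^ k) (Tie q) = Tie q"
  then have "q ((cyc m ^^ k) 1) = q 1" by (metis funpow_shift_Tie row_class.inject o_apply)
  then have "(cyc m ^^ k) 1 = 1" using permutes_inj[OF q] by (auto dest: injD)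
  then show False using k funpow_cyc[of 0 m k] by simp
qed

section \<open>Classes of parallel arcs of tuples\<close>

text \<open>Restriction to \<open>J\<close> gives every vertex one representative, so that equality
  of vertices is equality of functions.\<close>

definition tail_orders :: "'j set \<Rightarrow> nat \<Rightarrow> ('j \<Rightarrow> nat \<Rightarrow> nat) \<Rightarrow> 'j \<Rightarrow> (nat \<times> nat) set" where
  "tail_orders J m \<pi> = (\<lambda>j\<in>J. order_on m (\<pi> j))"

definition head_orders :: "'j set \<Rightarrow> nat \<Rightarrow> ('j \<Rightarrow> nat \<Rightarrow> nat) \<Rightarrow> 'j \<Rightarrow> (nat \<times> nat) set" where
  "head_orders J m \<pi> = (\<lambda>j\<in>J. order_on m (\<pi> j \<circ> Suc))"

abbreviation perm_tuples :: "'j set \<Rightarrow> nat \<Rightarrow> ('j \<Rightarrow> nat \<Rightarrow> nat) set" where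
  "perm_tuples J m \<equiv> (\<Pi>\<^sub>E j\<in>J. {p. p permutes {1..m}})"

definition classes :: "'j set \<Rightarrow> nat \<Rightarrow> ('j \<Rightarrow> row_class) set" where
  "classes J m = (\<Pi>\<^sub>E j\<in>J. row_classes m)"

definition box :: "'j set \<Rightarrow> nat \<Rightarrow> ('j \<Rightarrow> row_class) \<Rightarrow> ('j \<Rightarrow> nat \<Rightarrow> nat) set" where
  "box J m c = (\<Pi>\<^sub>E j\<in>J. row_box m (c j))"

definition shift_all :: "'j set \<Rightarrow> nat \<Rightarrow> ('j \<Rightarrow> row_class) \<Rightarrow> 'j \<Rightarrow> row_class" where
  "shift_all J m c = (\<lambda>j\<in>J. shift m (c j))"

definition class_tail :: "'j set \<Rightarrow> nat \<Rightarrow> ('j \<Rightarrow> row_class) \<Rightarrow> 'j \<Rightarrow> (nat \<times> nat) set" where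
  "class_tail J m c = (\<lambda>j\<in>J. row_tail m (c j))"

lemma bij_betw_PiE_restrict:
  assumes "bij_betw f A A"
  shows "bij_betw (\<lambda>c. \<lambda>j\<in>J. f (c j)) (\<Pi>\<^sub>E j\<in>J. A) (\<Pi>\<^sub>E j\<in>J. A)"
proof (rule bij_betw_byWitness[where f' = "\<lambda>c. \<lambda>j\<in>J. inv_into A f (c j)"])
  have f: "f x \<in> A" "inv_into A f (f x) = x" "inv_into A f x \<in> A" "f (inv_into A f x) = x" if "x \<in> A" for x
    using assms that by (auto simp: bij_betw_def inv_into_into f_inv_into_f)
  show "\<forall>c\<in>\<Pi>\<^sub>E j\<in>J. A. (\<lambda>j\<in>J. inv_into A f ((\<lambda>j\<in>J. f (c j)) j)) = c"
    using f(2) by (auto simp: fun_eq_iff PiE_iff extensional_def)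
  show "\<forall>c\<in>\<Pi>\<^sub>E j\<in>J. A. (\<lambda>j\<in>J. f ((\<lambda>j\<in>J. inv_into A f (c j)) j)) = c"
    using f(4) by (auto simp: fun_eq_iff PiE_iff extensional_def)
  show "(\<lambda>c. \<lambda>j\<in>J. f (c j)) ` (\<Pi>\<^sub>E j\<in>J. A) \<subseteq> (\<Pi>\<^sub>E j\<in>J. A)" using f(1) by (auto dest: PiE_mem)
  show "(\<lambda>c. \<lambda>j\<in>J. inv_into A f (c j)) ` (\<Pi>\<^sub>E j\<in>J. A) \<subseteq> (\<Pi>\<^sub>E j\<in>J. A)" using f(3) by (auto dest: PiE_mem)
qed

lemma bij_betw_shift_all: "bij_betw (shift_all J m) (classes J m) (classes J m)"
  using bij_betw_PiE_restrict[OF bij_betw_shift] unfolding shift_all_def classes_def .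

lemma funpow_shift_all:
  assumes "c \<in> classes J m"
  shows "(shift_all J m ^^ k) c = (\<lambda>j\<in>J. (shift m ^^ k) (c j))"
proof (induction k)
  case 0
  show ?case using assms by (simp add: classes_def PiE_iff extensional_restrict)
next
  case (Suc k)
  have "(shift_all J m ^^ Suc k) c = shift_all J m (\<lambda>j\<in>J. (shift m ^^ k) (c j))"
    by (simp only: funpow.simps o_apply Suc)
  also have "\<dots> = (\<lambda>j\<in>J. (shift m ^^ Suc k) (c j))" by (auto simp: shift_all_def)
  finally show ?case .
qed

lemma finite_classes: "finite J \<Longrightarrow> finite (classes J m)"
  by (auto simp: classes_def finite_row_classes intro: finite_PiE)

lemma box_nonempty: "box J m c \<noteq> {}"
  by (auto simp: box_def PiE_eq_empty_iff row_box_nonempty)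

lemma finite_box: "finite J \<Longrightarrow> finite (box J m c)"
  by (auto simp: box_def finite_row_box intro: finite_PiE)

lemma box_disjoint:
  assumes "c \<in> classes J m" "c' \<in> classes J m" "m \<ge> 2" "\<pi> \<in> box J m c" "\<pi> \<in> box J m c'"
  shows "c = c'"
proof (rule PiE_ext)
  show "c \<in> (\<Pi>\<^sub>E j\<in>J. row_classes m)" "c' \<in> (\<Pi>\<^sub>E j\<in>J. row_classes m)"
    using assms by (auto simp: classes_def)
  show "c j = c' j" if "j \<in> J" for j
    using assms that by (intro row_box_disjoint[of "c j" m "c' j" "\<pi> j"]) (auto simp: classes_def box_def)
qed

text \<open>Expanding a product of row sums; each row contributes two loops and
  \<open>fact m\<close> pairs.\<close>

lemma sum_card_box:
  assumes "finite J" "m \<ge> 1"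
  shows "(\<Sum>c\<in>classes J m. card (box J m c)) = (2 + 2 * fact m) ^ card J"
proof -
  have "(\<Sum>c\<in>classes J m. card (box J m c)) = (\<Sum>c\<in>classes J m. \<Prod>j\<in>J. card (row_box m (c j)))"
    using assms by (simp add: box_def card_PiE)
  also have "\<dots> = (\<Prod>j\<in>J. \<Sum>r\<in>row_classes m. card (row_box m r))"
    unfolding classes_def using assms finite_row_classes by (subst prod_sum_PiE) auto
  finally show ?thesis using assms by (simp add: sum_card_row_box)
qed

text \<open>One block must survive in each class, so the capacity of a class is its size minus 1.
  Positive capacity forces a \<open>Tie\<close> row, and such a class has exact period
  \<open>m\<close> under the shift, as the orbit argument requires.\<close>

lemma invariant_class_weight:
  assumes J: "finite J" and m: "m \<ge> 1"
    and i: "i * m + (2 + fact m) ^ card J \<le> (2 + 2 * fact m) ^ card J"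
  obtains l where "\<And>c. c \<in> classes J m \<Longrightarrow> l c < card (box J m c)"
    "\<And>c. c \<in> classes J m \<Longrightarrow> l (shift_all J m c) = l c"
    "(\<Sum>c\<in>classes J m. l c) = i * m"
proof -
  let ?cap = "\<lambda>c. card (box J m c) - 1"
  have pos: "card (box J m c) \<ge> 1" for c
    using finite_box[OF J] box_nonempty by (metis One_nat_def Suc_leI card_gt_0_iff)
  have card_box: "card (box J m c) = (\<Prod>j\<in>J. card (row_box m (c j)))" for c
    using J by (simp add: box_def card_PiE)
  \<comment> \<open>There are \<open>(2 + fact m) ^ card J\<close> classes, so the capacities add up
    to the difference of the two powers in the assumption \<open>i\<close>.\<close>
  have "(\<Sum>c\<in>classes J m. ?cap c) + card (classes J m) = (\<Sum>c\<in>classes J m. ?cap c + 1)"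
    by (simp only: sum.distrib sum_constant) simp
  also have "\<dots> = (\<Sum>c\<in>classes J m. card (box J m c))"
    by (simp only: le_add_diff_inverse2[OF pos])
  also have "\<dots> = (2 + 2 * fact m) ^ card J" using sum_card_box[OF J m] .
  finally have "i * m \<le> (\<Sum>c\<in>classes J m. ?cap c)"
    using i J by (simp add: classes_def card_PiE card_row_classes)
  have cap_shift: "?cap (shift_all J m c) = ?cap c" for c
    using m by (simp add: card_box shift_all_def card_row_box_shift)
  have period: "(shift_all J m ^^ m) c = c" if "c \<in> classes J m" for c
    using that by (simp add: funpow_shift_all funpow_shift_self) (simp add: classes_def PiE_iff extensional_restrict)
  have exact: "(shift_all J m ^^ k) c \<noteq> c"
    if c: "c \<in> classes J m" "?cap c > 0" and k: "0 < k" "k < m" for c k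
  proof -
    have "\<exists>j\<in>J. card (row_box m (c j)) \<noteq> 1"
    proof (rule ccontr)
      assume "\<not> ?thesis"
      then have "card (box J m c) = 1" by (simp add: card_box)
      then show False using c by simp
    qed
    then obtain j q where j: "j \<in> J" "c j = Tie q"
      using card_row_box[OF m] by (metis row_class.exhaust row_class.simps(8,9))
    then have "q permutes {1..m}" using c by (auto simp: classes_def row_classes_def PiE_iff)
    then have "(shift m ^^ k) (c j) \<noteq> c j" using funpow_shift_neq j k by simp
    then show ?thesis using j by (auto simp: funpow_shift_all[OF c(1)] dest: fun_cong[of _ _ j])
  qed
  obtain l where l: "\<forall>c\<in>classes J m. l c \<le> ?cap c \<and> l (shift_all J m c) = l c"
    "(\<Sum>c\<in>classes J m. l c) = i * m"
    using invariant_weight_with_sum[OF finite_classes[OF J] bij_betw_shift_all _ cap_shift period exact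
        \<open>i * m \<le> _\<close>] m by auto
  show thesis
  proof (rule that[of l])
    show "l c < card (box J m c)" if "c \<in> classes J m" for c
      using l(1) that pos[of c] by fastforce
  qed (use l in auto)
qed

lemma box_orders:
  assumes c: "c \<in> classes J m" and m: "m \<ge> 1" and \<pi>: "\<pi> \<in> box J m c"
  shows "\<pi> \<in> perm_tuples J (Suc m)" "tail_orders J m \<pi> = class_tail J m c"
    "head_orders J m \<pi> = class_tail J m (shift_all J m c)"
proof -
  have r: "c j \<in> row_classes m" "\<pi> j \<in> row_box m (c j)" if "j \<in> J" for j
    using c \<pi> that by (auto simp: classes_def box_def)
  show "\<pi> \<in> perm_tuples J (Suc m)"
    using \<pi> row_box_permutes[OF r(1) m r(2)] by (auto simp: PiE_iff box_def)
  show "tail_orders J m \<pi> = class_tail J m c"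
    using row_box_order_on(1)[OF r(1) m r(2)] by (auto simp: tail_orders_def class_tail_def intro!: restrict_ext)
  show "head_orders J m \<pi> = class_tail J m (shift_all J m c)"
    using row_box_order_on(2)[OF r(1) m r(2)] by (auto simp: head_orders_def class_tail_def shift_all_def intro!: restrict_ext)
qed

text \<open>Cyclically rotating the columns turns heads into tails, so the overlap graph is balanced.\<close>

lemma rotation:
  obtains rot where "bij_betw rot (perm_tuples J (Suc m)) (perm_tuples J (Suc m))"
    "\<And>\<pi>. tail_orders J m (rot \<pi>) = head_orders J m \<pi>"
proof
  let ?rot = "\<lambda>\<pi>. \<lambda>j\<in>J. \<pi> j \<circ> cyc (Suc m)"
  show "bij_betw ?rot (perm_tuples J (Suc m)) (perm_tuples J (Suc m))"
    using bij_betw_PiE_restrict[OF bij_betw_comp_permutation[OF cyc_permutes[of "Suc m"]], of J] .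
  show "tail_orders J m (?rot \<pi>) = head_orders J m \<pi>" for \<pi>
  proof -
    have "order_on m (\<pi> j \<circ> cyc (Suc m)) = order_on m (\<pi> j \<circ> Suc)" for j
      by (rule order_on_cong) (auto simp: cyc_def)
    then show ?thesis by (auto simp: tail_orders_def head_orders_def fun_eq_iff)
  qed
qed

text \<open>The rotation maps the arcs entering \<open>v\<close> bijectively onto the arcs leaving
  \<open>v\<close>.\<close>

lemma card_tail_eq_card_head:
  "card {\<pi> \<in> perm_tuples J (Suc m). tail_orders J m \<pi> = v} =
   card {\<pi> \<in> perm_tuples J (Suc m). head_orders J m \<pi> = v}"
proof -
  obtain rot where rot: "bij_betw rot (perm_tuples J (Suc m)) (perm_tuples J (Suc m))"
    "\<And>\<pi>. tail_orders J m (rot \<pi>) = head_orders J m \<pi>" by (rule rotation[of J m]) blast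
  let ?A = "{\<pi> \<in> perm_tuples J (Suc m). head_orders J m \<pi> = v}"
  have im: "rot ` ?A = {\<pi> \<in> perm_tuples J (Suc m). tail_orders J m \<pi> = v}"
  proof (intro equalityI subsetI)
    fix \<pi> assume \<pi>: "\<pi> \<in> {\<pi> \<in> perm_tuples J (Suc m). tail_orders J m \<pi> = v}"
    then have "\<pi> \<in> rot ` perm_tuples J (Suc m)"
      unfolding bij_betw_imp_surj_on[OF rot(1)] by blast
    then obtain \<rho> where "\<rho> \<in> perm_tuples J (Suc m)" "\<pi> = rot \<rho>" by blast
    then show "\<pi> \<in> rot ` ?A" using rot(2)[of \<rho>] \<pi> by simp
  next
    fix \<pi> assume "\<pi> \<in> rot ` ?A"
    then obtain \<rho> where \<rho>: "\<rho> \<in> perm_tuples J (Suc m)" "head_orders J m \<rho> = v" "\<pi> = rot \<rho>"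
      by blast
    have "rot \<rho> \<in> perm_tuples J (Suc m)" using rot(1) \<rho>(1) by (rule bij_betw_apply)
    moreover have "tail_orders J m (rot \<rho>) = v" unfolding rot(2) by (rule \<rho>(2))
    ultimately show "\<pi> \<in> {\<pi> \<in> perm_tuples J (Suc m). tail_orders J m \<pi> = v}"
      unfolding \<rho>(3) by (intro CollectI conjI)
  qed
  have "inj_on rot ?A" using bij_betw_imp_inj_on[OF rot(1)] by (rule inj_on_subset) auto
  then have "card (rot ` ?A) = card ?A" by (rule card_image)
  then show ?thesis unfolding im .
qed

section \<open>Balanced families of blocks\<close>

text \<open>The choice of \<open>\<pi>\<close> is harmless: on the blocks considered below the orders are constant.\<close>

definition block_tail :: "'j set \<Rightarrow> nat \<Rightarrow> ('j \<Rightarrow> nat \<Rightarrow> nat) set \<Rightarrow> 'j \<Rightarrow> (nat \<times> nat) set" where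
  "block_tail J m B = tail_orders J m (SOME \<pi>. \<pi> \<in> B)"

definition block_head :: "'j set \<Rightarrow> nat \<Rightarrow> ('j \<Rightarrow> nat \<Rightarrow> nat) set \<Rightarrow> 'j \<Rightarrow> (nat \<times> nat) set" where
  "block_head J m B = head_orders J m (SOME \<pi>. \<pi> \<in> B)"

text \<open>Each class is cut into as many boxes as its size minus its weight, and all remaining
  tuples stay single. As the weight is invariant under the shift, every vertex loses equally many
  incoming and outgoing arcs, so the balance of the full overlap graph survives.\<close>

lemma balanced_blocks:
  fixes J :: "'j set"
  assumes J: "finite J" and m: "m \<ge> 2"
    and i: "i * m + (2 + fact m) ^ card J \<le> (2 + 2 * fact m) ^ card J"
  obtains P where "partition_on (perm_tuples J (Suc m)) P"
    "card P + i * m = fact (Suc m) ^ card J"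
    "\<And>B. B \<in> P \<Longrightarrow> \<exists>b. B = PiE J b \<and> (\<forall>j\<in>J. b j \<in> row_blocks m)"
    "\<And>B \<pi>. B \<in> P \<Longrightarrow> \<pi> \<in> B \<Longrightarrow> tail_orders J m \<pi> = block_tail J m B"
    "\<And>B \<pi>. B \<in> P \<Longrightarrow> \<pi> \<in> B \<Longrightarrow> head_orders J m \<pi> = block_head J m B"
    "\<And>v. card {B \<in> P. block_tail J m B = v} = card {B \<in> P. block_head J m B = v}"
proof -
  let ?M = "perm_tuples J (Suc m)" and ?C = "classes J m"
  have m1: "m \<ge> 1" using m by simp
  have finM: "finite ?M" using J by (intro finite_PiE) (auto simp: finite_permutations)
  obtain l where l: "\<And>c. c \<in> ?C \<Longrightarrow> l c < card (box J m c)"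
    "\<And>c. c \<in> ?C \<Longrightarrow> l (shift_all J m c) = l c" "(\<Sum>c\<in>?C. l c) = i * m"
    using invariant_class_weight[OF J m1 i] by blast
  define X where "X = \<Union>(box J m ` ?C)"
  define S where "S = (\<lambda>\<pi>. {\<pi>}) ` (?M - X)"
  define K where "K = box J m ` ?C \<union> S"
  have inj: "inj_on (box J m) ?C"
  proof (rule inj_onI)
    fix c c' assume c: "c \<in> ?C" "c' \<in> ?C" "box J m c = box J m c'"
    obtain \<pi> where "\<pi> \<in> box J m c" using box_nonempty by blast
    then show "c = c'" using box_disjoint[OF c(1,2) m, of \<pi>] c(3) by simp
  qed
  have XM: "X \<subseteq> ?M" using box_orders(1)[OF _ m1] unfolding X_def by blast
  have disj: "box J m ` ?C \<inter> S = {}"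
  proof (rule ccontr)
    assume "\<not> ?thesis"
    then obtain c \<pi> where "c \<in> ?C" "\<pi> \<notin> X" "box J m c = {\<pi>}" by (auto simp: S_def)
    then show False by (auto simp: X_def)
  qed
  have K: "partition_on ?M K"
  proof (rule partition_onI)
    show "\<Union>K = ?M" using XM by (auto simp: K_def S_def X_def)
    show "{} \<notin> K" using box_nonempty by (auto simp: K_def S_def)
  next
    fix p q assume pq: "p \<in> K" "q \<in> K" "p \<noteq> q"
    have 1: "disjnt p q" if "p \<in> box J m ` ?C" "q \<in> box J m ` ?C" "p \<noteq> q" for p q
      using that box_disjoint[OF _ _ m] by (fastforce simp: disjnt_def)
    have 2: "disjnt p q" "disjnt q p" if "p \<in> box J m ` ?C" "q \<in> S" for p q
      using that by (auto simp: disjnt_def S_def X_def)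
    have 3: "disjnt p q" if "p \<in> S" "q \<in> S" "p \<noteq> q" for p q
      using that by (auto simp: disjnt_def S_def)
    show "disjnt p q" using pq(1,2) unfolding K_def by (elim UnE) (simp_all only: 1[OF _ _ pq(3)] 2 3[OF _ _ pq(3)])
  qed
  \<comment> \<open>The weight is carried over from the indexing tuples to the boxes themselves and
    is 0 on the untouched singletons.\<close>
  define l' where "l' k = (if k \<in> box J m ` ?C then l (inv_into ?C (box J m) k) else 0)" for k
  have l'_box: "l' (box J m c) = l c" if "c \<in> ?C" for c
    using that inj by (simp add: l'_def)
  have l'_S: "l' k = 0" if "k \<in> S" for k using that disj by (auto simp: l'_def)
  have "\<exists>Q. partition_on k Q \<and> card Q + l' k = card k \<and>
      (\<forall>B\<in>Q. \<exists>b. B = PiE J b \<and> (\<forall>j\<in>J. b j \<in> row_blocks m))" if k: "k \<in> K" for k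
  proof (cases "k \<in> S")
    case True
    then obtain \<pi> where \<pi>: "\<pi> \<in> ?M" "k = {\<pi>}" by (auto simp: S_def)
    then have "k = (\<Pi>\<^sub>E j\<in>J. {\<pi> j})" using PiE_singleton[of \<pi> J] by (auto simp: PiE_def)
    moreover have "{\<pi> j} \<in> row_blocks m" if "j \<in> J" for j
      using that \<pi>(1) by (auto simp: row_blocks_def PiE_iff)
    moreover have "partition_on k {k}" "card k = 1" using \<pi>(2) by (simp_all add: partition_on_space)
    ultimately show ?thesis using l'_S[OF True]
      by (intro exI[of _ "{k}"]) auto
  next
    case False
    then obtain c where c: "c \<in> ?C" "k = box J m c" using k by (auto simp: K_def)
    \<comment> \<open>The strict bound on the weight leaves at least one block for each
      class.\<close>
    have "1 \<le> card k - l c" using l(1)[OF c(1)] c(2) by simp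
    then have "\<exists>Q. partition_on k Q \<and> card Q = card k - l c \<and>
      (\<forall>B\<in>Q. \<exists>b. B = PiE J b \<and> (\<forall>j\<in>J. b j \<subseteq> row_box m (c j) \<and> b j \<noteq> {}))"
      unfolding c(2) box_def
      by (intro partition_into_boxes J finite_row_box row_box_nonempty) simp_all
    then obtain Q where Q0: "partition_on k Q \<and> card Q = card k - l c \<and>
      (\<forall>B\<in>Q. \<exists>b. B = PiE J b \<and> (\<forall>j\<in>J. b j \<subseteq> row_box m (c j) \<and> b j \<noteq> {}))"
      by (rule exE)
    note Q = Q0[THEN conjunct1] Q0[THEN conjunct2, THEN conjunct1]
      bspec[OF Q0[THEN conjunct2, THEN conjunct2]]
    have "\<exists>b. B = PiE J b \<and> (\<forall>j\<in>J. b j \<in> row_blocks m)" if BQ: "B \<in> Q" for B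
    proof -
      obtain b where b: "B = PiE J b \<and> (\<forall>j\<in>J. b j \<subseteq> row_box m (c j) \<and> b j \<noteq> {})"
        using Q(3)[OF BQ] by (rule exE)
      have "b j \<in> row_blocks m" if "j \<in> J" for j
        using b that c(1) by (intro row_box_subset_row_blocks[of "c j", OF _ m1]) (auto simp: classes_def)
      then show ?thesis using b by (intro exI[of _ b] conjI ballI) simp_all
    qed
    moreover have "card Q + l' k = card k" using Q(2) l(1)[OF c(1)] l'_box[OF c(1)] c(2) by simp
    ultimately show ?thesis using Q(1) by (intro exI[of _ Q] conjI ballI)
  qed
  then obtain part where part: "\<And>k. k \<in> K \<Longrightarrow> partition_on k (part k)"
    "\<And>k. k \<in> K \<Longrightarrow> card (part k) + l' k = card k"
    "\<And>k B. k \<in> K \<Longrightarrow> B \<in> part k \<Longrightarrow> \<exists>b. B = PiE J b \<and> (\<forall>j\<in>J. b j \<in> row_blocks m)"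
    by metis
  define P where "P = \<Union>(part ` K)"
  have partP: "partition_on ?M P" unfolding P_def using K part(1) by (rule partition_on_refine)
  have const: "tail_orders J m \<pi> = tail_orders J m \<rho> \<and> head_orders J m \<pi> = head_orders J m \<rho>"
    if asm: "k \<in> K" "\<pi> \<in> k" "\<rho> \<in> k" for k \<pi> \<rho>
  proof (cases "k \<in> S")
    case True
    then show ?thesis using asm by (auto simp: S_def)
  next
    case False
    then obtain c where c: "c \<in> ?C" "k = box J m c" using asm(1) by (auto simp: K_def)
    note o = box_orders(2,3)[OF c(1) m1]
    show ?thesis
      using o[OF asm(2)[unfolded c(2)]] o[OF asm(3)[unfolded c(2)]] by simp
  qed
  have some: "(SOME \<pi>. \<pi> \<in> B) \<in> B" if "B \<in> P" for B
  proof -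
    have "B \<noteq> {}" using that partition_onD3[OF partP] by metis
    then show ?thesis by (simp add: some_in_eq)
  qed
  have someK: "(SOME \<pi>. \<pi> \<in> k) \<in> k" if "k \<in> K" for k
  proof -
    have "k \<noteq> {}" using that partition_onD3[OF K] by metis
    then show ?thesis by (simp add: some_in_eq)
  qed
  have sub: "B \<subseteq> k" if "k \<in> K" "B \<in> part k" for k B using part(1)[OF that(1)] that(2) by (auto simp: partition_on_def)
  have BP: "B \<in> P" if "k \<in> K" "B \<in> part k" for k B using that by (auto simp: P_def)
  \<comment> \<open>One count for an arbitrary \<open>f\<close> that is constant on classes. A
    constant \<open>f\<close>, the tail and the head give the total number of arcs, the out-degrees
    and the in-degrees.\<close>
  have count: "card {B \<in> P. f (SOME \<pi>. \<pi> \<in> B) = v} + (\<Sum>c\<in>{c \<in> ?C. f' c = v}. l c) = card {\<pi> \<in> ?M. f \<pi> = v}"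
    if f: "\<And>k \<pi> \<rho>. k \<in> K \<Longrightarrow> \<pi> \<in> k \<Longrightarrow> \<rho> \<in> k \<Longrightarrow> f \<pi> = f \<rho>"
      and f': "\<And>c \<pi>. c \<in> ?C \<Longrightarrow> \<pi> \<in> box J m c \<Longrightarrow> f \<pi> = f' c"
    for f :: "('j \<Rightarrow> nat \<Rightarrow> nat) \<Rightarrow> 'v" and f' v
  proof -
    let ?g = "\<lambda>k. f (SOME \<pi>. \<pi> \<in> k)"
    have 1: "card {B \<in> P. ?g B = v} + (\<Sum>k\<in>{k \<in> K. ?g k = v}. l' k) = card {\<pi> \<in> ?M. f \<pi> = v}"
      unfolding P_def
    proof (rule partition_refine_count[OF K finM part(1,2)])
      show "f \<pi> = ?g k" if "k \<in> K" "\<pi> \<in> k" for k \<pi> using f[OF that someK[OF that(1)]] .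
      show "?g B = ?g k" if "k \<in> K" "B \<in> part k" for k B
        using f[OF that(1) _ someK[OF that(1)]] some[OF BP[OF that]] sub[OF that] by blast
    qed
    have g: "?g (box J m c) = f' c" if "c \<in> ?C" for c
      using f'[OF that] someK[of "box J m c"] that by (simp add: K_def)
    have finC: "finite ?C" using finite_classes[OF J] .
    have "(\<Sum>k\<in>{k \<in> K. ?g k = v}. l' k) = (\<Sum>k\<in>{k \<in> box J m ` ?C. ?g k = v}. l' k)"
    proof (rule sum.mono_neutral_right)
      show "finite {k \<in> K. ?g k = v}" using finite_elements[OF finM K] by simp
    qed (auto simp: K_def l'_S)
    also have "{k \<in> box J m ` ?C. ?g k = v} = box J m ` {c \<in> ?C. f' c = v}"
      using g by auto
    also have "(\<Sum>k\<in>\<dots>. l' k) = (\<Sum>c\<in>{c \<in> ?C. f' c = v}. l' (box J m c))"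
      using inj by (subst sum.reindex) (auto intro: inj_on_subset)
    also have "\<dots> = (\<Sum>c\<in>{c \<in> ?C. f' c = v}. l c)" by (intro sum.cong) (auto simp: l'_box)
    finally show ?thesis using 1 by simp
  qed
  have "card {B \<in> P. (\<lambda>_. ()) (SOME \<pi>. \<pi> \<in> B) = ()} + (\<Sum>c\<in>{c \<in> ?C. (\<lambda>_. ()) c = ()}. l c)
      = card {\<pi> \<in> ?M. (\<lambda>_. ()) \<pi> = ()}"
    by (rule count) auto
  then have cardP: "card P + i * m = fact (Suc m) ^ card J"
    using J l(3) by (simp add: card_PiE card_permutations del: fact_Suc)
  \<comment> \<open>Reindexing by the shift turns heads into tails while the weights stay the same,
    so the losses on both sides agree at every vertex.\<close>
  have sh: "(\<Sum>c\<in>{c \<in> ?C. class_tail J m (shift_all J m c) = v}. l c) = (\<Sum>c\<in>{c \<in> ?C. class_tail J m c = v}. l c)" for v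
  proof -
    have "(\<Sum>c\<in>?C. if class_tail J m c = v then l c else 0) =
        (\<Sum>c\<in>?C. if class_tail J m (shift_all J m c) = v then l (shift_all J m c) else 0)"
      using sum.reindex_bij_betw[OF bij_betw_shift_all, symmetric] .
    also have "\<dots> = (\<Sum>c\<in>?C. if class_tail J m (shift_all J m c) = v then l c else 0)"
      using l(2) by (intro sum.cong) auto
    finally show ?thesis using finite_classes[OF J] by (simp add: sum.inter_filter)
  qed
  have ct: "card {B \<in> P. block_tail J m B = v} + (\<Sum>c\<in>{c \<in> ?C. class_tail J m c = v}. l c) = card {\<pi> \<in> ?M. tail_orders J m \<pi> = v}" for v
    unfolding block_tail_def using const box_orders(2)[OF _ m1] by (intro count) blast+
  have ch: "card {B \<in> P. block_head J m B = v} + (\<Sum>c\<in>{c \<in> ?C. class_tail J m (shift_all J m c) = v}. l c) = card {\<pi> \<in> ?M. head_orders J m \<pi> = v}" for v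
    unfolding block_head_def using const box_orders(3)[OF _ m1] by (intro count) blast+
  have balance: "card {B \<in> P. block_tail J m B = v} = card {B \<in> P. block_head J m B = v}" for v
    using sh[of v] ct[of v] ch[of v] card_tail_eq_card_head[of J m v] by linarith
  have blk: "tail_orders J m \<pi> = block_tail J m B" "head_orders J m \<pi> = block_head J m B"
    if B: "B \<in> P" "\<pi> \<in> B" for B \<pi>
  proof -
    obtain k where k: "k \<in> K" "B \<in> part k" using B(1) by (auto simp: P_def)
    then have "\<pi> \<in> k" "(SOME \<pi>. \<pi> \<in> B) \<in> k" using sub[OF k] B(2) some[OF B(1)] by auto
    then show "tail_orders J m \<pi> = block_tail J m B" "head_orders J m \<pi> = block_head J m B"
      using const[OF k(1)] unfolding block_tail_def block_head_def by blast+
  qed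
  show thesis
    by (rule that[OF partP cardP _ blk balance]) (use part(3) in \<open>auto simp: P_def\<close>)
qed

section \<open>Eulerian trails of blocks\<close>

lemma order_on_prefix_suffix:
  assumes "order_on (Suc m) v = order_on (Suc m) w"
  shows "order_on m v = order_on m w" "order_on m (v \<circ> Suc) = order_on m (w \<circ> Suc)"
  using assms by (simp_all add: order_on_eq_iff)

lemma (in pre_digraph) cas_nth:
  assumes "cas u p v" "Suc k < length p"
  shows "head G (p ! k) = tail G (p ! Suc k)"
  using assms
proof (induction p arbitrary: u k)
  case (Cons e p)
  then show ?case by (cases k; cases p) auto
qed simp

text \<open>The blocks become the arcs of a finite digraph, balanced by \<open>bal\<close>. Once any
  vertex is shown to be reachable from any other, an Eulerian trail lists every block exactly
  once.\<close>

lemma block_trail: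
  fixes J :: "'j set"
  assumes J: "finite J" and P: "partition_on (perm_tuples J (Suc m)) P"
    and tl: "\<And>B \<pi>. B \<in> P \<Longrightarrow> \<pi> \<in> B \<Longrightarrow> tail_orders J m \<pi> = block_tail J m B"
    and hd: "\<And>B \<pi>. B \<in> P \<Longrightarrow> \<pi> \<in> B \<Longrightarrow> head_orders J m \<pi> = block_head J m B"
    and bal: "\<And>v. card {B \<in> P. block_tail J m B = v} = card {B \<in> P. block_head J m B = v}"
  obtains p where "distinct p" "set p = P"
    "\<And>k. Suc k < length p \<Longrightarrow> block_head J m (p ! k) = block_tail J m (p ! Suc k)"
proof -
  let ?M = "perm_tuples J (Suc m)"
  define G where "G = \<lparr>verts = tail_orders J m ` ?M, arcs = P, tail = block_tail J m, head = block_head J m\<rparr>"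
  have G: "verts G = tail_orders J m ` ?M" "arcs G = P" "tail G = block_tail J m" "head G = block_head J m"
    by (simp_all add: G_def)
  have finM: "finite ?M" using J by (intro finite_PiE) (auto simp: finite_permutations)
  obtain rot where rot: "bij_betw rot ?M ?M" "\<And>\<pi>. tail_orders J m (rot \<pi>) = head_orders J m \<pi>"
    by (rule rotation[of J m]) blast
  have rep: "\<exists>\<pi>\<in>?M. \<pi> \<in> B" if "B \<in> P" for B
    using that partition_onD1[OF P] partition_onD3[OF P] by (metis UnionI all_not_in_conv)
  have cover: "\<exists>B\<in>P. \<pi> \<in> B" if "\<pi> \<in> ?M" for \<pi>
    using that unfolding partition_onD1[OF P] by (rule UnionE) (rule bexI)
  interpret G: fin_digraph G
  proof
    show "finite (verts G)" using finM by (simp add: G)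
    show "finite (arcs G)" using finite_elements[OF finM P] by (simp add: G)
  next
    fix B assume "B \<in> arcs G"
    then have B: "B \<in> P" by (simp add: G)
    then obtain \<pi> where \<pi>: "\<pi> \<in> ?M" "\<pi> \<in> B" using rep by blast
    show "tail G B \<in> verts G" unfolding G tl[OF B \<pi>(2), symmetric] using \<pi>(1) by (rule imageI)
    show "head G B \<in> verts G" unfolding G hd[OF B \<pi>(2), symmetric] rot(2)[symmetric]
      using bij_betw_apply[OF rot(1) \<pi>(1)] by (rule imageI)
  qed
  \<comment> \<open>Merging parallel arcs never removes the last of them, so every tuple still
    yields an arc from its tail to its head.\<close>
  have arc: "tail_orders J m \<pi> \<rightarrow>\<^bsub>G\<^esub> head_orders J m \<pi>" if \<pi>: "\<pi> \<in> ?M" for \<pi>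
  proof -
    obtain B where B: "B \<in> P" "\<pi> \<in> B" using cover[OF \<pi>] by blast
    show ?thesis unfolding tl[OF B] hd[OF B]
      by (rule G.dominatesI[of B]) (simp_all add: arc_to_ends_def G B)
  qed
  have reach: "tail_orders J m \<pi> \<rightarrow>\<^sup>*\<^bsub>G\<^esub> tail_orders J m \<pi>'" if \<pi>: "\<pi> \<in> ?M" "\<pi>' \<in> ?M" for \<pi> \<pi>'
  proof -
    \<comment> \<open>slide along the concatenation of \<open>\<pi>\<close> with a copy of \<open>\<pi>'\<close> raised above it\<close>
    define u where "u j c = (if c \<le> m then \<pi> j c else Suc m + \<pi>' j (c - m))" for j c
    define V where "V s = (\<lambda>j\<in>J. order_on m (\<lambda>a. u j (s + a)))" for s
    have step: "V s \<rightarrow>\<^bsub>G\<^esub> V (Suc s)" if s: "s < m" for s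
    proof -
      \<comment> \<open>A window of width \<open>Suc m\<close> on the concatenation has distinct
        entries, so its reduced form provides the arc from \<open>V s\<close> to
        \<open>V (Suc s)\<close>.\<close>
      have "\<exists>p. p permutes {1..Suc m} \<and> order_on (Suc m) p = order_on (Suc m) (\<lambda>a. u j (s + a))"
        if j: "j \<in> J" for j
      proof -
        have perm: "\<pi> j permutes {1..Suc m}" "\<pi>' j permutes {1..Suc m}" using \<pi> j by (auto simp: PiE_iff)
        have inj: "\<pi> j x = \<pi> j y \<longleftrightarrow> x = y" "\<pi>' j x = \<pi>' j y \<longleftrightarrow> x = y" for x y
          using inj_eq[OF permutes_inj[OF perm(1)]] inj_eq[OF permutes_inj[OF perm(2)]] by auto
        \<comment> \<open>Letters of the first part are at most \<open>Suc m\<close> and those of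
          the raised part exceed it, so no value occurs in both.\<close>
        have bound: "\<pi> j x < Suc m + \<pi>' j y" if "1 \<le> x" "x \<le> m" "1 \<le> y" "y \<le> m" for x y
          using that permutes_in_seg[OF perm(1), of x] permutes_in_seg[OF perm(2), of y] by auto
        have "inj_on (\<lambda>a. u j (s + a)) {1..Suc m}"
        proof (rule linorder_inj_onI)
          fix a b assume ab: "a < b" "a \<in> {1..Suc m}" "b \<in> {1..Suc m}"
          have "s + b - m \<le> m" "s + b \<le> m \<or> Suc 0 \<le> s + b - m" using ab s by auto
          then show "u j (s + a) \<noteq> u j (s + b)"
            using ab inj bound[of "s + a" "s + b - m"]
            by (cases "s + b \<le> m"; cases "s + a \<le> m") (auto simp: u_def)
        qed auto
        then show ?thesis using standardization by metis
      qed
      then obtain p where p: "\<And>j. j \<in> J \<Longrightarrow> p j permutes {1..Suc m}"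
        "\<And>j. j \<in> J \<Longrightarrow> order_on (Suc m) (p j) = order_on (Suc m) (\<lambda>a. u j (s + a))"
        by metis
      define \<rho> where "\<rho> = (\<lambda>j\<in>J. p j)"
      have "\<rho> \<in> ?M" using p(1) by (auto simp: \<rho>_def)
      moreover have "tail_orders J m \<rho> = V s"
        using order_on_prefix_suffix(1)[OF p(2)] by (auto simp: tail_orders_def \<rho>_def V_def intro!: restrict_ext)
      moreover have "head_orders J m \<rho> = V (Suc s)"
        using order_on_prefix_suffix(2)[OF p(2)]
        by (auto simp: head_orders_def \<rho>_def V_def o_def intro!: restrict_ext)
      ultimately show ?thesis using arc[of \<rho>] by simp
    qed
    have V0: "V 0 = tail_orders J m \<pi>" unfolding V_def tail_orders_def
      by (intro restrict_ext order_on_cong) (auto simp: u_def)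
    have "order_on m (\<lambda>a. u j (m + a)) = order_on m (\<pi>' j)" for j
      by (auto simp: order_on_eq_iff u_def)
    then have Vm: "V m = tail_orders J m \<pi>'" by (simp add: V_def tail_orders_def)
    have "V 0 \<rightarrow>\<^sup>*\<^bsub>G\<^esub> V s" if "s \<le> m" for s
      using that
    proof (induction s)
      case 0
      have "V 0 \<in> verts G" unfolding V0 G using \<pi>(1) by (rule imageI)
      then show ?case by (rule G.reachable_refl)
    next
      case (Suc s)
      then show ?case using step[of s] by (auto intro: G.reachable_adj_trans)
    qed
    then show ?thesis using V0 Vm by (metis le_refl)
  qed
  have con: "connected G"
  proof (rule G.connectedI)
    have "{p. p permutes {1..Suc m}} \<noteq> {}" using permutes_id by blast
    then have "?M \<noteq> {}" by (simp add: PiE_eq_empty_iff)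
    then show "verts G \<noteq> {}" by (simp add: G)
    show "v \<rightarrow>\<^sup>*\<^bsub>mk_symmetric G\<^esub> w" if "v \<in> verts G" "w \<in> verts G" for v w
      using that reach G.reachable_mk_symmetricI unfolding G by blast
  qed
  have "in_degree G v = out_degree G v" for v
    using bal[of v] by (simp add: in_degree_def out_degree_def in_arcs_def out_arcs_def G)
  then obtain v p where "G.euler_trail v p v" using G.closed_euler1[OF con] by blast
  then have p: "distinct p" "set p = P" "G.cas v p v"
    by (auto simp: G.euler_trail_def G.trail_def G.awalk_def G)
  show thesis
  proof (rule that[OF p(1,2)])
    show "block_head J m (p ! k) = block_tail J m (p ! Suc k)" if "Suc k < length p" for k
      using G.cas_nth[OF p(3) that] by (simp add: G)
  qed
qed

section \<open>Reading the word off a trail of blocks\<close>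

lemma encodes_iff_encoded:
  assumes "\<pi> \<in> multi_perms d n"
  shows "encodes d n W \<pi> \<longleftrightarrow> (\<forall>j\<in>{2..d}. \<pi> j \<in> encoded n (W j))"
proof -
  have "\<pi> j permutes {1..n}" if "j \<in> {2..d}" for j
    using assms that by (auto simp: multi_perms_def PiE_iff)
  then show ?thesis
    unfolding encodes_def encoded_def mem_Collect_eq subset_iff split_paired_All mem_order_on by blast
qed

text \<open>The window starting in column \<open>k + 1\<close> encodes exactly the block at index
  \<open>k\<close>, indices starting at 0. Blocks are disjoint and listed without repetition, so the
  window covering a tuple exists and is unique.\<close>

lemma u_word_of_partition:
  assumes P: "partition_on (multi_perms d (Suc m)) (set p)" "distinct p" and ne: "p \<noteq> []"
    and pos: "\<And>j c. j \<in> {2..d} \<Longrightarrow> 0 < U j c"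
    and enc: "\<And>k. k < length p \<Longrightarrow> p ! k = (\<Pi>\<^sub>E j\<in>{2..d}. encoded (Suc m) (\<lambda>a. U j (k + a)))"
  shows "u_word d (Suc m) (length p + m) U"
proof -
  have iff: "encodes d (Suc m) (window U (Suc k)) \<pi> \<longleftrightarrow> \<pi> \<in> p ! k"
    if "\<pi> \<in> multi_perms d (Suc m)" "k < length p" for \<pi> k
    using that unfolding encodes_iff_encoded[OF that(1)] enc[OF that(2)]
    by (auto simp: window_def multi_perms_def PiE_iff)
  have "\<exists>!s. s \<in> {1..length p} \<and> encodes d (Suc m) (window U s) \<pi>"
    if \<pi>: "\<pi> \<in> multi_perms d (Suc m)" for \<pi>
  proof -
    obtain B where "B \<in> set p" "\<pi> \<in> B" using \<pi> unfolding partition_onD1[OF P(1)] by (rule UnionE)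
    then obtain k where k: "k < length p" "\<pi> \<in> p ! k" by (auto simp: in_set_conv_nth)
    show ?thesis
    proof (rule ex1I[of _ "Suc k"])
      show "Suc k \<in> {1..length p} \<and> encodes d (Suc m) (window U (Suc k)) \<pi>"
        using k iff[OF \<pi>] by simp
    next
      fix s assume s: "s \<in> {1..length p} \<and> encodes d (Suc m) (window U s) \<pi>"
      then obtain k' where k': "s = Suc k'" "k' < length p" by (cases s) auto
      then have "\<pi> \<in> p ! k'" using s iff[OF \<pi>] by simp
      then have "p ! k' = p ! k"
        using disjointD[OF partition_onD2[OF P(1)], of "p ! k'" "p ! k"] k k' by auto
      then show "s = Suc k" using k k' P(2) by (simp add: nth_eq_iff_index_eq)
    qed
  qed
  \<comment> \<open>Subtraction on naturals is truncated, which is why the list has to be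
    nonempty.\<close>
  moreover have "length p + m - Suc m + 1 = length p" "Suc m \<le> length p + m"
    using ne by (cases p; simp)+
  ultimately show ?thesis using pos unfolding u_word_def by simp
qed

text \<open>Multiplying by \<open>m\<close> clears the denominator, and absorbing
  \<open>2 ^ D\<close> into both powers makes all terms integers, so the bound can be stated over
  the naturals.\<close>

lemma scaled_difference_bound:
  assumes "real i \<le> 2 ^ D / real m * ((1 + fact m) ^ D - (1 + fact m / 2) ^ D)" and m: "m \<ge> 1"
  shows "i * m + (2 + fact m) ^ D \<le> (2 + 2 * fact m) ^ D"
proof -
  have "real i * real m \<le> 2 ^ D * ((1 + fact m) ^ D - (1 + fact m / 2) ^ D)"
    using assms by (simp add: field_simps)
  also have "\<dots> = (2 * (1 + fact m)) ^ D - (2 * (1 + fact m / 2)) ^ D"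
    by (simp only: right_diff_distrib power_mult_distrib)
  also have "\<dots> = (2 + 2 * fact m) ^ D - (2 + fact m) ^ D" by (simp add: algebra_simps)
  finally have "real (i * m + (2 + fact m) ^ D) \<le> real ((2 + 2 * fact m) ^ D)" by simp
  then show ?thesis by (simp only: of_nat_le_iff)
qed

theorem theorem1p1:
  fixes n d i :: nat
  assumes "n \<ge> 3" and "d \<ge> 2"
    and "real i \<le> 2 ^ (d - 1) / (real n - 1) *
           ((1 + fact (n - 1)) ^ (d - 1) - (1 + fact (n - 1) / 2) ^ (d - 1))"
  shows "\<exists>L U. int L = (fact n) ^ (d - 1) + int n - 1 - int i * (int n - 1) \<and> u_word d n L U"
proof -
  define m where "m = n - 1"
  let ?J = "{2..d}"
  have n: "n = Suc m" and m: "m \<ge> 2" using assms(1) by (auto simp: m_def)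
  have D: "card ?J = d - 1" by simp
  have "i * m + (2 + fact m) ^ card ?J \<le> (2 + 2 * fact m) ^ card ?J"
    unfolding D using assms(3) m by (intro scaled_difference_bound) (simp_all add: n)
  then obtain P where P: "partition_on (perm_tuples ?J (Suc m)) P"
    "card P + i * m = fact (Suc m) ^ card ?J"
    "\<And>B. B \<in> P \<Longrightarrow> \<exists>b. B = PiE ?J b \<and> (\<forall>j\<in>?J. b j \<in> row_blocks m)"
    "\<And>B \<pi>. B \<in> P \<Longrightarrow> \<pi> \<in> B \<Longrightarrow> tail_orders ?J m \<pi> = block_tail ?J m B"
    "\<And>B \<pi>. B \<in> P \<Longrightarrow> \<pi> \<in> B \<Longrightarrow> head_orders ?J m \<pi> = block_head ?J m B"
    "\<And>v. card {B \<in> P. block_tail ?J m B = v} = card {B \<in> P. block_head ?J m B = v}"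
    using balanced_blocks[of ?J m i] m by blast
  obtain p where p: "distinct p" "set p = P"
    "\<And>k. Suc k < length p \<Longrightarrow> block_head ?J m (p ! k) = block_tail ?J m (p ! Suc k)"
    by (rule block_trail[of ?J m P]) (use P(1,4-6) in auto)
  obtain b where b: "\<And>B. B \<in> P \<Longrightarrow> B = PiE ?J (b B)"
    "\<And>B j. B \<in> P \<Longrightarrow> j \<in> ?J \<Longrightarrow> b B j \<in> row_blocks m"
    using P(3) by metis
  have "perm_tuples ?J (Suc m) \<noteq> {}"
    by (auto simp: PiE_eq_empty_iff intro: permutes_id)
  then have ne: "p \<noteq> []" using partition_onD1[OF P(1)] p(2) by auto
  \<comment> \<open>A block is a product, so any \<open>q\<close> in its factor \<open>j\<close> can
    be substituted into a member without leaving the block. The tail and head of the block thus fix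
    the order of each such \<open>q\<close>.\<close>
  have orders: "order_on m q = block_tail ?J m B j" "order_on m (q \<circ> Suc) = block_head ?J m B j"
    if B: "B \<in> P" and j: "j \<in> ?J" and q: "q \<in> b B j" for B j q
  proof -
    have "B \<noteq> {}" using B partition_onD3[OF P(1)] by metis
    then obtain \<pi> where "\<pi> \<in> B" by blast
    then have \<pi>: "\<pi>(j := q) \<in> B" using b(1)[OF B] j q by (metis PiE_fun_upd insert_absorb)
    show "order_on m q = block_tail ?J m B j" "order_on m (q \<circ> Suc) = block_head ?J m B j"
      using P(4)[OF B \<pi>] P(5)[OF B \<pi>] j
      by (auto simp: tail_orders_def head_orders_def dest!: fun_cong[of _ _ j])
  qed
  have pk: "p ! k \<in> P" if "k < length p" for k using that p(2) by auto
  \<comment> \<open>The rows are spelled separately along the same trail; since every block is a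
    product of row blocks, the row words fit together into one matrix.\<close>
  have "\<exists>u :: nat \<Rightarrow> nat. (\<forall>c. 0 < u c) \<and>
      (\<forall>k<length p. encoded (Suc m) (\<lambda>a. u (k + a)) = b (p ! k) j)" if j: "j \<in> ?J" for j
  proof (rule row_word)
    \<comment> \<open>\<open>?v k\<close> is the pattern in front of block \<open>k\<close>. At
      index \<open>length p\<close> there is no next tail, so the head of the last block takes its
      place.\<close>
    let ?v = "\<lambda>k. if k < length p then block_tail ?J m (p ! k) j else block_head ?J m (p ! (k - 1)) j"
    show "b (p ! k) j \<in> row_blocks m" if "k < length p" for k using b(2) pk that j by blast
    show "order_on m q = ?v k" if "k < length p" "q \<in> b (p ! k) j" for k q
      using orders(1)[OF pk j] that by simp
    show "order_on m (q \<circ> Suc) = ?v (Suc k)" if "k < length p" "q \<in> b (p ! k) j" for k q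
      using orders(2)[OF pk j] that p(3)[of k] by simp
    show "length p \<ge> 1" using ne by (cases p) auto
  qed (use m in simp)
  then obtain U :: "nat \<Rightarrow> nat \<Rightarrow> nat" where U: "\<And>j c. j \<in> ?J \<Longrightarrow> 0 < U j c"
    "\<And>j k. j \<in> ?J \<Longrightarrow> k < length p \<Longrightarrow> encoded (Suc m) (\<lambda>a. U j (k + a)) = b (p ! k) j"
    by metis
  have "u_word d (Suc m) (length p + m) U"
  proof (rule u_word_of_partition[OF _ p(1) ne U(1)])
    show "partition_on (multi_perms d (Suc m)) (set p)" using P(1) p(2) by (simp add: multi_perms_def)
    show "p ! k = (\<Pi>\<^sub>E j\<in>?J. encoded (Suc m) (\<lambda>a. U j (k + a)))" if k: "k < length p" for k
    proof -
      have "p ! k = PiE ?J (b (p ! k))" using b(1)[OF pk[OF k]] .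
      also have "\<dots> = (\<Pi>\<^sub>E j\<in>?J. encoded (Suc m) (\<lambda>a. U j (k + a)))"
        by (rule PiE_cong) (simp add: U(2) k)
      finally show ?thesis .
    qed
  qed
  moreover have "int (length p + m) = fact n ^ (d - 1) + int n - 1 - int i * (int n - 1)"
  proof -
    have "length p = card P" using p(1,2) distinct_card by metis
    then have "int (length p) + int i * int m = int (fact (Suc m) ^ (d - 1))"
      using P(2) unfolding D by (metis of_nat_add of_nat_mult)
    then show ?thesis by (simp add: n algebra_simps del: fact_Suc)
  qed
  ultimately show ?thesis unfolding n by blast
qed

end
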